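(* Let $A$ be a (not necessarily bounded) normal operator in a complex Hilbert space $H$ such that $$|A|\leq |\overline{\mathrm{Re}\, A}|.$$ Then $A$ is self-adjoint.
   Context: Operators are linear, not necessarily bounded, defined on a subspace $D(T)$ of $H$. A densely defined operator $T$ is normal if it is closed and $TT^*=T^*T$; it is self-adjoint if $T=T^*$. For a densely defined $T$, $\mathrm{Re}\,T=\frac{T+T^*}{2}$ with domain $D(T)\cap D(T^* )$, and $\overline{\mathrm{Re}\,T}$ is its closure. For a closed densely defined operator $T$, $|T|$ denotes the unique positive self-adjoint square root of $T^*T$. For positive self-adjoint operators $S,T$ (possibly unbounded), $T\le S$ means $D(S^{1/2})\subset D(T^{1/2})$ and $\|T^{1/2}x\|\le\|S^{1/2}x\|$ for all $x\in D(S^{1/2})$. *)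

theory Defs
  imports "HOL-Analysis.Analysis"
begin

text \<open>
  Complex inner product spaces, built on top of \<^class>\<open>real_inner\<close> so that norm and topology are
  those of the library. Definiteness of \<open>cinner\<close> is inherited from \<^class>\<open>real_inner\<close>, because
  the real inner product is required to be the real part of \<open>cinner\<close>. The complex inner
  product is linear in its first argument.
\<close>

class complex_inner = real_inner +
  fixes scaleC :: "complex \<Rightarrow> 'a \<Rightarrow> 'a" (infixr "*\<^sub>C" 75)
    and cinner :: "'a \<Rightarrow> 'a \<Rightarrow> complex"
  assumes scaleC_add_right: "a *\<^sub>C (x + y) = a *\<^sub>C x + a *\<^sub>C y"
    and scaleC_add_left: "(a + b) *\<^sub>C x = a *\<^sub>C x + b *\<^sub>C x"
    and scaleC_scaleC: "a *\<^sub>C (b *\<^sub>C x) = (a * b) *\<^sub>C x"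
    and scaleC_of_real: "complex_of_real r *\<^sub>C x = r *\<^sub>R x"
    and cinner_commute: "cinner x y = cnj (cinner y x)"
    and cinner_add_left: "cinner (x + y) z = cinner x z + cinner y z"
    and cinner_scaleC_left: "cinner (a *\<^sub>C x) y = a * cinner x y"
    and inner_eq_Re_cinner: "inner x y = Re (cinner x y)"

class chilbert_space = complex_inner + complete_space

text \<open>
  A not necessarily bounded operator is a partial function: \<^term>\<open>dom T\<close> is its domain \<open>D(T)\<close>,
  \<^term>\<open>the (T x)\<close> is the value at \<open>x \<in> D(T)\<close>, and equality of operators includes equality of
  their domains. The product \<open>ST\<close>, with its natural domain
  \<open>{x \<in> D(T). Tx \<in> D(S)}\<close>, is \<^term>\<open>S \<circ>\<^sub>m T\<close>.
\<close>

type_synonym 'a operator = "'a \<rightharpoonup> 'a"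

definition linear_op :: "'a::complex_inner operator \<Rightarrow> bool" where
  "linear_op T \<longleftrightarrow>
     0 \<in> dom T \<and>
     (\<forall>x\<in>dom T. \<forall>y\<in>dom T. x + y \<in> dom T \<and> the (T (x + y)) = the (T x) + the (T y)) \<and>
     (\<forall>c. \<forall>x\<in>dom T. c *\<^sub>C x \<in> dom T \<and> the (T (c *\<^sub>C x)) = c *\<^sub>C the (T x))"

definition densely_defined :: "'a::complex_inner operator \<Rightarrow> bool" where
  "densely_defined T \<longleftrightarrow> closure (dom T) = UNIV"

definition closed_op :: "'a::complex_inner operator \<Rightarrow> bool" where
  "closed_op T \<longleftrightarrow> closed (Map.graph T)"

text \<open>The operator whose graph is the closure of the graph of \<open>T\<close>; meaningful for closable \<open>T\<close>.\<close>

definition op_closure :: "'a::complex_inner operator \<Rightarrow> 'a operator" where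
  "op_closure T = (\<lambda>x.
     if \<exists>y. (x, y) \<in> closure (Map.graph T)
     then Some (THE y. (x, y) \<in> closure (Map.graph T)) else None)"

text \<open>The adjoint; meaningful for densely defined \<open>T\<close>, where the vector \<open>z\<close> is unique.\<close>

definition op_adjoint :: "'a::complex_inner operator \<Rightarrow> 'a operator" where
  "op_adjoint T = (\<lambda>y.
     if \<exists>z. \<forall>x\<in>dom T. cinner (the (T x)) y = cinner x z
     then Some (THE z. \<forall>x\<in>dom T. cinner (the (T x)) y = cinner x z) else None)"

definition normal_op :: "'a::complex_inner operator \<Rightarrow> bool" where
  "normal_op T \<longleftrightarrow> linear_op T \<and> densely_defined T \<and> closed_op T \<and>
     T \<circ>\<^sub>m op_adjoint T = op_adjoint T \<circ>\<^sub>m T"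

definition self_adjoint_op :: "'a::complex_inner operator \<Rightarrow> bool" where
  "self_adjoint_op T \<longleftrightarrow> linear_op T \<and> densely_defined T \<and> T = op_adjoint T"

definition positive_op :: "'a::complex_inner operator \<Rightarrow> bool" where
  "positive_op T \<longleftrightarrow> (\<forall>x\<in>dom T. cinner (the (T x)) x \<in> \<real>\<^sub>\<ge>\<^sub>0)"

definition op_Re :: "'a::complex_inner operator \<Rightarrow> 'a operator" where
  "op_Re T = (\<lambda>x.
     if x \<in> dom T \<inter> dom (op_adjoint T)
     then Some ((1 / 2) *\<^sub>C (the (T x) + the (op_adjoint T x))) else None)"

text \<open>
  The positive self-adjoint square root; it exists and is unique when \<open>S\<close> is a positive
  self-adjoint operator on a Hilbert space.
\<close>

definition op_sqrt :: "'a::complex_inner operator \<Rightarrow> 'a operator" where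
  "op_sqrt S = (THE R. self_adjoint_op R \<and> positive_op R \<and> R \<circ>\<^sub>m R = S)"

definition op_abs :: "'a::complex_inner operator \<Rightarrow> 'a operator" where
  "op_abs T = op_sqrt (op_adjoint T \<circ>\<^sub>m T)"

text \<open>The form order \<open>T \<le> S\<close>, to be used for positive self-adjoint \<open>S\<close> and \<open>T\<close> only.\<close>

definition op_le :: "'a::complex_inner operator \<Rightarrow> 'a operator \<Rightarrow> bool" where
  "op_le T S \<longleftrightarrow> dom (op_sqrt S) \<subseteq> dom (op_sqrt T) \<and>
     (\<forall>x\<in>dom (op_sqrt S). norm (the (op_sqrt T x)) \<le> norm (the (op_sqrt S x)))"

end

theory Submission imports Defs begin

text \<open>
  Let \<open>B\<close> be the closure of the real part of the normal operator \<open>A\<close>, and put \<open>P = |A|\<close> and \<open>Q = |B|\<close>.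
  Normality means that \<open>A\<close> and \<open>A*\<close> have the same domain and that \<open>|A x| = |A* x|\<close> there
  (\<open>normal_op_adjoint\<close>). By the parallelogram law,
  \<open>|A x - A* x|^2 = 4 |A x|^2 - |A x + A* x|^2 = 4 (|P x|^2 - |Q x|^2)\<close> for \<open>x \<in> D(A)\<close>.
  Hence \<open>|Q x| \<le> |P x|\<close> on \<open>D(A) = D(P)\<close>, and the Heinz inequality (\<open>heinz_inequality\<close>) gives
  \<open>\<langle>Q x, x\<rangle> \<le> \<langle>P x, x\<rangle>\<close>. The hypothesis \<open>P \<le> Q\<close> is the opposite inequality. So the two forms agree
  on \<open>D(A)\<close>, and by polarisation \<open>P x = Q x\<close> for \<open>x \<in> D(A)\<close> (\<open>symmetric_forms_eq\<close>). The displayed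
  identity now says \<open>A x = A* x\<close>, that is, \<open>A = A*\<close>. Commutation of the real and
  imaginary parts and the spectral theorem are avoided altogether.

  The square roots and moduli in the statement are definite descriptions, so the argument rests on the
  existence and uniqueness of positive self-adjoint square roots of unbounded operators.
  Existence (\<open>positive_sqrt_exists\<close>) is reduced by the resolvent \<open>(1 + S)^-1\<close> to bounded
  contractions, where an explicit iteration converges (\<open>contraction_sqrt\<close>). Uniqueness
  (\<open>positive_sqrt_unique\<close>) follows from the Heinz inequality once more. The link between an operator
  \<open>T\<close> and \<open>T* T\<close> is von Neumann's theorem that \<open>1 + T* T\<close> is surjective
  (\<open>represents_form_adjoint_comp\<close>), and its consequence that \<open>T* T\<close> determines the domain of \<open>T\<close> and the
  norms \<open>|T x|\<close> (\<open>represents_form_same_dom_norm\<close>).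
\<close>

section \<open>Complex inner products and their real parts\<close>

lemma inner_scaleC: "inner (c *\<^sub>C x) y = inner x (cnj c *\<^sub>C (y::'a::complex_inner))"
proof -
  have "cinner x (cnj c *\<^sub>C y) = cnj (cinner (cnj c *\<^sub>C y) x)" by (rule cinner_commute)
  also have "\<dots> = c * cnj (cinner y x)" by (simp add: cinner_scaleC_left)
  also have "\<dots> = cinner (c *\<^sub>C x) y" by (simp add: cinner_scaleC_left cinner_commute[of x y])
  finally show ?thesis by (simp add: inner_eq_Re_cinner)
qed

lemma norm_scaleC: "norm (c *\<^sub>C x) = cmod c * norm (x::'a::complex_inner)"
proof -
  have "(norm (c *\<^sub>C x))\<^sup>2 = inner x ((cnj c * c) *\<^sub>C x)"
    by (simp add: power2_norm_eq_inner inner_scaleC scaleC_scaleC)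
  also have "cnj c * c = complex_of_real ((cmod c)\<^sup>2)"
    by (metis complex_norm_square mult.commute)
  also have "inner x (complex_of_real ((cmod c)\<^sup>2) *\<^sub>C x) = (cmod c * norm x)\<^sup>2"
    by (simp add: scaleC_of_real power2_norm_eq_inner power_mult_distrib del: of_real_power)
  finally show ?thesis by (simp add: power2_eq_iff_nonneg)
qed

lemma bounded_linear_scaleC: "bounded_linear (\<lambda>x::'a::complex_inner. c *\<^sub>C x)"
proof (rule bounded_linear_intro[where K = "cmod c"])
  fix r and x :: 'a
  show "c *\<^sub>C (r *\<^sub>R x) = r *\<^sub>R (c *\<^sub>C x)"
    by (simp add: scaleC_of_real[symmetric] scaleC_scaleC mult.commute)
qed (simp_all add: scaleC_add_right norm_scaleC mult.commute)

text \<open>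
  The real part of the inner product determines the complex one. Hence orthogonality, adjoints,
  symmetry and positivity can all be treated in the real inner product space, and the complex
  structure enters only through complex linearity.
\<close>

lemma cinner_eq_Complex:
  "cinner x y = Complex (inner x y) (inner x (\<i> *\<^sub>C (y::'a::complex_inner)))"
proof -
  have "cinner x (\<i> *\<^sub>C y) = - \<i> * cinner x y"
    by (subst (1 2) cinner_commute) (simp add: cinner_scaleC_left)
  then show ?thesis by (simp add: inner_eq_Re_cinner complex_eq_iff)
qed

section \<open>Orthogonal projection\<close>

lemma parallelogram_law:
  fixes x y :: "'b::real_inner"
  shows "(norm (x + y))\<^sup>2 + (norm (x - y))\<^sup>2 = 2 * (norm x)\<^sup>2 + 2 * (norm y)\<^sup>2"
  by (simp add: power2_norm_eq_inner inner_add_left inner_add_right inner_diff_left inner_diff_right)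

text \<open>
  By the parallelogram law a sequence in \<open>M\<close> that minimises the distance to \<open>x\<close> is Cauchy; its limit
  is a nearest point, and perturbing a nearest point along \<open>M\<close> gives the orthogonality.
\<close>

lemma orthogonal_projection_exists:
  fixes M :: "'b::{real_inner,complete_space} set"
  assumes sub: "subspace M" and cl: "closed M"
  shows "\<exists>m\<in>M. \<forall>v\<in>M. inner (x - m) v = 0"
proof -
  define d where "d = (INF m\<in>M. (norm (x - m))\<^sup>2)"
  have ne: "M \<noteq> {}" using sub subspace_0 by blast
  have bdd: "bdd_below ((\<lambda>m. (norm (x - m))\<^sup>2) ` M)" by (rule bdd_belowI2[of _ 0]) simp
  have dle: "d \<le> (norm (x - m))\<^sup>2" if "m \<in> M" for m
    unfolding d_def using bdd that by (rule cINF_lower)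
  have "\<exists>m\<in>M. (norm (x - m))\<^sup>2 < d + 1 / real (Suc n)" for n
    using cINF_less_iff[OF ne bdd, of "d + 1 / real (Suc n)"] by (simp add: d_def)
  then obtain f where fM: "\<And>n. f n \<in> M"
    and fd: "\<And>n. (norm (x - f n))\<^sup>2 < d + 1 / real (Suc n)" by metis
  have near: "(norm (f m - f n))\<^sup>2 \<le> 2 / real (Suc m) + 2 / real (Suc n)" for m n
  proof -
    have "(1/2) *\<^sub>R (f m + f n) \<in> M" using fM sub by (simp add: subspace_add subspace_scale)
    then have "d \<le> (norm (x - (1/2) *\<^sub>R (f m + f n)))\<^sup>2" by (rule dle)
    moreover have "(x - f m) + (x - f n) = 2 *\<^sub>R (x - (1/2) *\<^sub>R (f m + f n))"
      by (simp add: algebra_simps scaleR_2)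
    then have "(norm ((x - f m) + (x - f n)))\<^sup>2 = 4 * (norm (x - (1/2) *\<^sub>R (f m + f n)))\<^sup>2"
      by (simp add: power_mult_distrib)
    moreover have "norm ((x - f m) - (x - f n)) = norm (f m - f n)" by (simp add: norm_minus_commute)
    ultimately show ?thesis
      using parallelogram_law[of "x - f m" "x - f n"] fd[of m] fd[of n] by simp
  qed
  have "Cauchy f"
  proof (rule metric_CauchyI)
    fix e :: real assume e: "0 < e"
    then obtain N where N: "4 / e\<^sup>2 < real N" using reals_Archimedean2 by blast
    have "dist (f m) (f n) < e" if "m \<ge> N" "n \<ge> N" for m n
    proof -
      have "2 / real (Suc k) < e\<^sup>2 / 2" if "k \<ge> N" for k
      proof -
        have "4 / e\<^sup>2 < real (Suc k)" using N that by linarith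
        then show ?thesis using e by (simp add: field_simps)
      qed
      then have "(norm (f m - f n))\<^sup>2 < e\<^sup>2" using near[of m n] that by (smt (verit) field_sum_of_halves)
      then show ?thesis using e by (simp add: dist_norm power2_less_imp_less)
    qed
    then show "\<exists>N. \<forall>m\<ge>N. \<forall>n\<ge>N. dist (f m) (f n) < e" by blast
  qed
  then obtain m where lim: "f \<longlonglongrightarrow> m" using Cauchy_convergent convergentD by blast
  have mM: "m \<in> M" using cl fM lim closed_sequentially by blast
  have "(\<lambda>n. d + 1 / real (Suc n)) \<longlonglongrightarrow> d + 0"
    by (intro tendsto_intros LIMSEQ_inverse_real_of_nat[unfolded inverse_eq_divide])
  moreover have "(\<lambda>n. (norm (x - f n))\<^sup>2) \<longlonglongrightarrow> (norm (x - m))\<^sup>2"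
    by (intro tendsto_intros lim)
  ultimately have md: "(norm (x - m))\<^sup>2 \<le> d"
    using fd by (metis (no_types, lifting) LIMSEQ_le add_0_right less_imp_le)
  have "inner (x - m) v = 0" if v: "v \<in> M" for v
  proof (cases "v = 0")
    case False
    \<comment> \<open>the minimiser of the quadratic polynomial \<open>t \<mapsto> |(x - m) - t v|^2\<close>\<close>
    define t where "t = inner (x - m) v / (norm v)\<^sup>2"
    have "m + t *\<^sub>R v \<in> M" using mM v sub by (simp add: subspace_add subspace_scale)
    then have "(norm (x - m))\<^sup>2 \<le> (norm ((x - m) - t *\<^sub>R v))\<^sup>2"
      using dle md by (metis diff_diff_eq order_trans)
    also have "\<dots> = (norm (x - m))\<^sup>2 - 2 * t * inner (x - m) v + t\<^sup>2 * (norm v)\<^sup>2"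
      unfolding power2_norm_eq_inner inner_diff_left[of "x - m"] inner_diff_right[of _ "x - m"]
      by (simp add: inner_commute[of v "x - m"] power2_eq_square)
    also have "\<dots> = (norm (x - m))\<^sup>2 - (inner (x - m) v)\<^sup>2 / (norm v)\<^sup>2"
      using False by (simp add: t_def field_simps power2_eq_square)
    finally have "(inner (x - m) v)\<^sup>2 / (norm v)\<^sup>2 \<le> 0" by simp
    then show ?thesis using False by (simp add: divide_le_0_iff)
  qed simp
  with mM show ?thesis by blast
qed

lemma subspace_closure:
  fixes M :: "'b::real_normed_vector set"
  assumes "subspace M"
  shows "subspace (closure M)"
  unfolding subspace_def
proof (intro conjI ballI allI)
  show "0 \<in> closure M" using assms closure_subset subspace_0 by blast
next
  fix x y assume "x \<in> closure M" "y \<in> closure M"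
  then obtain f g where "\<And>n. f n \<in> M" "f \<longlonglongrightarrow> x" "\<And>n. g n \<in> M" "g \<longlonglongrightarrow> y"
    by (metis closure_sequential)
  then show "x + y \<in> closure M"
    unfolding closure_sequential
    by (intro exI[of _ "\<lambda>n. f n + g n"]) (auto intro: tendsto_add subspace_add[OF assms])
next
  fix c x assume "x \<in> closure M"
  then obtain f where "\<And>n. f n \<in> M" "f \<longlonglongrightarrow> x" by (metis closure_sequential)
  then show "c *\<^sub>R x \<in> closure M"
    unfolding closure_sequential
    by (intro exI[of _ "\<lambda>n. c *\<^sub>R f n"])
      (auto intro: tendsto_scaleR subspace_scale[OF assms])
qed

lemma dense_if_orthogonal_trivial:
  fixes M :: "'b::{real_inner,complete_space} set"
  assumes sub: "subspace M" and triv: "\<And>y. (\<And>v. v \<in> M \<Longrightarrow> inner y v = 0) \<Longrightarrow> y = 0"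
  shows "closure M = UNIV"
proof -
  have "x \<in> closure M" for x
  proof -
    obtain m where m: "m \<in> closure M" "\<And>v. v \<in> closure M \<Longrightarrow> inner (x - m) v = 0"
      using orthogonal_projection_exists[of "closure M" x] sub by (auto simp: subspace_closure)
    then have "x - m = 0" using triv closure_subset by blast
    then show ?thesis using m by simp
  qed
  then show ?thesis by blast
qed

lemma orthogonal_to_dense:
  fixes M :: "'b::real_inner set"
  assumes "closure M = UNIV" and "\<And>v. v \<in> M \<Longrightarrow> inner y v = 0"
  shows "y = 0"
proof -
  have "closed {v. inner y v = 0}" by (intro closed_Collect_eq continuous_intros)
  then have "closure M \<subseteq> {v. inner y v = 0}" using assms(2) by (intro closure_minimal) auto
  then have "inner y y = 0" using assms(1) by blast
  then show ?thesis by simp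
qed

section \<open>Linear operators and adjoints\<close>

text \<open>
  Membership in the domain of an operator is treated as an atomic statement from here on: replacing
  it by an equation for the value would destroy the hypotheses of the lemmas on linear operators.
\<close>

declare domIff [iff del]

lemma operator_eqI:
  assumes "dom T = dom U" and "\<And>x. x \<in> dom T \<Longrightarrow> the (T x) = the (U x)"
  shows "T = U"
proof
  fix x
  have "x \<in> dom T \<longleftrightarrow> x \<in> dom U" by (simp only: assms(1))
  then show "T x = U x"
    using assms(2)[of x] by (auto simp: domIff)
qed

lemma linear_op_subspace: "linear_op T \<Longrightarrow> subspace (dom T)"
  unfolding linear_op_def subspace_def scaleC_of_real[symmetric] by blast

lemma linear_op_0: "linear_op T \<Longrightarrow> 0 \<in> dom T"
  and linear_op_add_dom: "linear_op T \<Longrightarrow> x \<in> dom T \<Longrightarrow> y \<in> dom T \<Longrightarrow> x + y \<in> dom T"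
  and linear_op_add: "linear_op T \<Longrightarrow> x \<in> dom T \<Longrightarrow> y \<in> dom T \<Longrightarrow>
        the (T (x + y)) = the (T x) + the (T y)"
  and linear_op_scaleC_dom: "linear_op T \<Longrightarrow> x \<in> dom T \<Longrightarrow> c *\<^sub>C x \<in> dom T"
  and linear_op_scaleC: "linear_op T \<Longrightarrow> x \<in> dom T \<Longrightarrow> the (T (c *\<^sub>C x)) = c *\<^sub>C the (T x)"
  by (simp_all add: linear_op_def)

lemma linear_op_scaleR_dom: "linear_op T \<Longrightarrow> x \<in> dom T \<Longrightarrow> r *\<^sub>R x \<in> dom T"
  and linear_op_scaleR: "linear_op T \<Longrightarrow> x \<in> dom T \<Longrightarrow> the (T (r *\<^sub>R x)) = r *\<^sub>R the (T x)"
  using linear_op_scaleC_dom[of T x "complex_of_real r"] linear_op_scaleC[of T x "complex_of_real r"]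
  by (simp_all add: scaleC_of_real)

lemma linear_op_diff_dom: "linear_op T \<Longrightarrow> x \<in> dom T \<Longrightarrow> y \<in> dom T \<Longrightarrow> x - y \<in> dom T"
  by (rule subspace_diff[OF linear_op_subspace])

lemma linear_op_diff: "linear_op T \<Longrightarrow> x \<in> dom T \<Longrightarrow> y \<in> dom T \<Longrightarrow>
    the (T (x - y)) = the (T x) - the (T y)"
  using linear_op_add[of T x "(-1) *\<^sub>R y"] linear_op_scaleR[of T y "-1"]
    linear_op_scaleR_dom[of T y "-1"] by simp

lemma linear_op_zero: "linear_op T \<Longrightarrow> the (T 0) = 0"
  using linear_op_scaleR[of T 0 0] linear_op_0[of T] by simp

lemma linear_opI:
  assumes "0 \<in> dom T"
    and "\<And>x y. x \<in> dom T \<Longrightarrow> y \<in> dom T \<Longrightarrow> T (x + y) = Some (the (T x) + the (T y))"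
    and "\<And>c x. x \<in> dom T \<Longrightarrow> T (c *\<^sub>C x) = Some (c *\<^sub>C the (T x))"
  shows "linear_op T"
  unfolding linear_op_def
proof (intro conjI ballI allI)
  fix x y assume "x \<in> dom T" "y \<in> dom T"
  then show "x + y \<in> dom T" "the (T (x + y)) = the (T x) + the (T y)"
    using assms(2)[of x y] by (auto intro: domI)
next
  fix c x assume "x \<in> dom T"
  then show "c *\<^sub>C x \<in> dom T" "the (T (c *\<^sub>C x)) = c *\<^sub>C the (T x)"
    using assms(3)[of x c] by (auto intro: domI)
qed (rule assms(1))

lemma closed_op_limit:
  assumes "closed_op T" and "\<And>n. v n \<in> dom T" and "v \<longlonglongrightarrow> x" and "(\<lambda>n. the (T (v n))) \<longlonglongrightarrow> y"
  shows "T x = Some y"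
proof -
  have "(\<lambda>n. (v n, the (T (v n)))) \<longlonglongrightarrow> (x, y)" using assms by (intro tendsto_Pair)
  moreover have "(v n, the (T (v n))) \<in> Map.graph T" for n
    using assms(2)[of n] by (auto simp: graph_def domIff)
  ultimately have "(x, y) \<in> Map.graph T"
    using assms(1) closed_sequentially[of "Map.graph T" "\<lambda>n. (v n, the (T (v n)))"]
    unfolding closed_op_def by simp
  then show ?thesis by (simp add: graph_def)
qed

lemma in_dom_map_comp: "x \<in> dom (T \<circ>\<^sub>m U) \<longleftrightarrow> x \<in> dom U \<and> the (U x) \<in> dom T"
  and the_map_comp: "x \<in> dom U \<Longrightarrow> the ((T \<circ>\<^sub>m U) x) = the (T (the (U x)))"
  by (auto simp: domIff map_comp_def split: option.splits)

lemma linear_op_comp: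
  assumes "linear_op T" and "linear_op U"
  shows "linear_op (T \<circ>\<^sub>m U)"
  unfolding linear_op_def
  using assms by (auto simp: in_dom_map_comp the_map_comp linear_op_add linear_op_scaleC linear_op_zero
      linear_op_add_dom linear_op_scaleC_dom linear_op_0)

text \<open>
  The real inner product suffices to describe the adjoint: since \<open>dom T\<close> is invariant under
  multiplication by \<open>\<i>\<close>, the real identity at \<open>-\<i> x\<close> is the identity of the imaginary parts at \<open>x\<close>.
  Density makes the value \<open>z\<close> unique, so the definite description is harmless.
\<close>

lemma op_adjoint_eq_Some:
  assumes lin: "linear_op T" and dense: "densely_defined T"
  shows "op_adjoint T y = Some z \<longleftrightarrow> (\<forall>x\<in>dom T. inner (the (T x)) y = inner x z)"
proof -
  have uniq: "z = z'" if "\<forall>x\<in>dom T. inner x z = inner x z'" for z z'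
    using orthogonal_to_dense[of "dom T" "z - z'"] dense that
    by (simp add: densely_defined_def inner_diff_left inner_commute[of z] inner_commute[of z'])
  have *: "(\<forall>x\<in>dom T. cinner (the (T x)) y = cinner x z) \<longleftrightarrow>
      (\<forall>x\<in>dom T. inner (the (T x)) y = inner x z)" for z
  proof
    assume "\<forall>x\<in>dom T. cinner (the (T x)) y = cinner x z"
    then show "\<forall>x\<in>dom T. inner (the (T x)) y = inner x z" by (simp add: inner_eq_Re_cinner)
  next
    assume h: "\<forall>x\<in>dom T. inner (the (T x)) y = inner x z"
    show "\<forall>x\<in>dom T. cinner (the (T x)) y = cinner x z"
    proof
      fix x assume x: "x \<in> dom T"
      have "inner (the (T (cnj \<i> *\<^sub>C x))) y = inner (cnj \<i> *\<^sub>C x) z"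
        using h linear_op_scaleC_dom[OF lin x] by blast
      then have "inner (the (T x)) (\<i> *\<^sub>C y) = inner x (\<i> *\<^sub>C z)"
        using linear_op_scaleC[OF lin x, of "cnj \<i>"] by (simp only: inner_scaleC complex_cnj_cnj)
      then show "cinner (the (T x)) y = cinner x z" using h x by (simp add: cinner_eq_Complex)
    qed
  qed
  have the_eq: "(THE z. \<forall>x\<in>dom T. inner (the (T x)) y = inner x z) = z"
    if "\<forall>x\<in>dom T. inner (the (T x)) y = inner x z" for z
    using that uniq by (intro the_equality) auto
  show ?thesis unfolding op_adjoint_def * using the_eq by (auto split: if_splits)
qed

lemma op_adjoint_inner:
  assumes "linear_op T" and "densely_defined T" and "x \<in> dom T" and "y \<in> dom (op_adjoint T)"
  shows "inner (the (T x)) y = inner x (the (op_adjoint T y))"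
proof -
  have "op_adjoint T y = Some (the (op_adjoint T y))" using assms(4) by (auto simp: domIff)
  then show ?thesis using op_adjoint_eq_Some[OF assms(1,2)] assms(3) by blast
qed

lemma linear_op_adjoint:
  assumes lin: "linear_op T" and dense: "densely_defined T"
  shows "linear_op (op_adjoint T)"
proof (rule linear_opI)
  note adj = op_adjoint_eq_Some[OF lin dense]
  note inn = op_adjoint_inner[OF lin dense]
  have "op_adjoint T 0 = Some 0" by (simp add: adj)
  then show "0 \<in> dom (op_adjoint T)" by (rule domI)
  fix x y assume x: "x \<in> dom (op_adjoint T)"
  show "op_adjoint T (x + y) = Some (the (op_adjoint T x) + the (op_adjoint T y))"
    if "y \<in> dom (op_adjoint T)" using x that by (simp add: adj inner_add_right inn)
  show "op_adjoint T (c *\<^sub>C x) = Some (c *\<^sub>C the (op_adjoint T x))" for c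
    unfolding adj
  proof
    fix v assume v: "v \<in> dom T"
    have "inner (the (T v)) (c *\<^sub>C x) = inner (the (T (cnj c *\<^sub>C v))) x"
      using linear_op_scaleC[OF lin v, of "cnj c"] by (simp add: inner_scaleC)
    also have "\<dots> = inner v (c *\<^sub>C the (op_adjoint T x))"
      using inn[OF linear_op_scaleC_dom[OF lin v] x] by (simp add: inner_scaleC)
    finally show "inner (the (T v)) (c *\<^sub>C x) = inner v (c *\<^sub>C the (op_adjoint T x))" .
  qed
qed

text \<open>
  The graph of the adjoint is cut out by equations that are continuous in both components.
\<close>

lemma closed_op_adjoint:
  assumes lin: "linear_op T" and dense: "densely_defined T"
  shows "closed_op (op_adjoint T)"
proof -
  have "Map.graph (op_adjoint T) = (\<Inter>x\<in>dom T. {p. inner (the (T x)) (fst p) = inner x (snd p)})"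
    by (auto simp: graph_def op_adjoint_eq_Some[OF lin dense])
  moreover have "closed (\<Inter>x\<in>dom T. {p. inner (the (T x)) (fst p) = inner x (snd p)})"
    by (intro closed_INT ballI closed_Collect_eq continuous_intros)
  ultimately show ?thesis by (simp add: closed_op_def)
qed

lemma self_adjoint_opD:
  assumes "self_adjoint_op T"
  shows "linear_op T" and "densely_defined T" and "op_adjoint T = T"
proof -
  note sa = assms[unfolded self_adjoint_op_def]
  show "linear_op T" and "densely_defined T" using sa by blast+
  show "op_adjoint T = T" by (rule sa[THEN conjunct2, THEN conjunct2, symmetric])
qed

lemma self_adjoint_closed: "self_adjoint_op T \<Longrightarrow> closed_op T"
  using closed_op_adjoint[of T] by (simp add: self_adjoint_opD)

lemma self_adjoint_inner:
  assumes "self_adjoint_op T" and "x \<in> dom T" and "y \<in> dom T"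
  shows "inner (the (T x)) y = inner x (the (T y))"
  using assms op_adjoint_inner[of T x y] by (simp add: self_adjoint_opD)

lemma positive_op_iff_inner:
  assumes sa: "self_adjoint_op T"
  shows "positive_op T \<longleftrightarrow> (\<forall>x\<in>dom T. 0 \<le> inner (the (T x)) x)"
proof -
  have "cinner (the (T x)) x = complex_of_real (inner (the (T x)) x)" if x: "x \<in> dom T" for x
  proof -
    have lin: "linear_op T" by (rule self_adjoint_opD(1)[OF sa])
    have "inner (the (T x)) (\<i> *\<^sub>C x) = inner x (\<i> *\<^sub>C the (T x))"
      using self_adjoint_inner[OF sa x linear_op_scaleC_dom[OF lin x]] linear_op_scaleC[OF lin x]
      by simp
    also have "\<dots> = - inner (the (T x)) (\<i> *\<^sub>C x)"
    proof -
      have "inner x (\<i> *\<^sub>C the (T x)) = inner (cnj \<i> *\<^sub>C x) (the (T x))" by (simp only: inner_scaleC complex_cnj_cnj)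
      also have "cnj \<i> *\<^sub>C x = - (\<i> *\<^sub>C x)"
        using scaleC_scaleC[of "-1" "\<i>" x] scaleC_of_real[of "-1" "\<i> *\<^sub>C x"] by simp
      finally show ?thesis by (simp add: inner_commute)
    qed
    finally have "inner (the (T x)) (\<i> *\<^sub>C x) = 0" by simp
    then show ?thesis by (simp add: cinner_eq_Complex complex_eq_iff)
  qed
  then show ?thesis by (simp add: positive_op_def)
qed

section \<open>Operators of the form T* T\<close>

text \<open>
  In the language of quadratic forms, \<open>S\<close> is the self-adjoint operator of the closed form
  \<open>x \<mapsto> |T x|^2\<close>. Surjectivity of \<open>1 + S\<close> is what ensures that \<open>dom S\<close> is large enough. The typical case is
  \<open>S = T* T\<close>, but one and the same \<open>S\<close> is compared below with several operators: with \<open>A\<close> and \<open>A*\<close> for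
  a normal operator \<open>A\<close>, with \<open>T\<close> and \<open>|T|\<close>, and with any two square roots of \<open>S\<close>.
\<close>

definition represents_form :: "'a::complex_inner operator \<Rightarrow> 'a operator \<Rightarrow> bool" where
  "represents_form S T \<longleftrightarrow> linear_op S \<and> linear_op T \<and> closed_op T \<and> dom S \<subseteq> dom T \<and>
     (\<forall>x\<in>dom T. \<forall>v\<in>dom S. inner (the (T x)) (the (T v)) = inner x (the (S v))) \<and>
     (\<forall>h. \<exists>v\<in>dom S. v + the (S v) = h)"

lemma represents_formD:
  assumes "represents_form S T"
  shows "linear_op S" "linear_op T" "closed_op T" "dom S \<subseteq> dom T"
    and "\<And>x v. x \<in> dom T \<Longrightarrow> v \<in> dom S \<Longrightarrow> inner (the (T x)) (the (T v)) = inner x (the (S v))"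
    and "\<And>h. \<exists>v\<in>dom S. v + the (S v) = h"
  using assms unfolding represents_form_def by blast+

lemma represents_form_symmetric:
  assumes "represents_form S T" and "v \<in> dom S" and "w \<in> dom S"
  shows "inner (the (S v)) w = inner v (the (S w))"
  using represents_formD(5)[OF assms(1), of v w] represents_formD(5)[OF assms(1), of w v]
    represents_formD(4)[OF assms(1)] assms(2,3)
  by (simp add: subset_iff inner_commute)

lemma represents_form_norm:
  assumes "represents_form S T" and "v \<in> dom S"
  shows "(norm (the (T v)))\<^sup>2 = inner v (the (S v))"
  using represents_formD(5)[OF assms(1), of v v] represents_formD(4)[OF assms(1)] assms(2)
  by (simp add: subset_iff power2_norm_eq_inner)

lemma subspace_graph_on:
  assumes lin: "linear_op T" and sub: "subspace D" "D \<subseteq> dom T"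
  shows "subspace ((\<lambda>v. (v, the (T v))) ` D)"
  unfolding subspace_def
proof (intro conjI ballI allI)
  show "0 \<in> (\<lambda>v. (v, the (T v))) ` D"
    using subspace_0[OF sub(1)] linear_op_zero[OF lin] by (auto simp: zero_prod_def image_iff)
next
  fix p q assume "p \<in> (\<lambda>v. (v, the (T v))) ` D" "q \<in> (\<lambda>v. (v, the (T v))) ` D"
  then obtain v w where vw: "v \<in> D" "w \<in> D" "p = (v, the (T v))" "q = (w, the (T w))" by blast
  have "v \<in> dom T" "w \<in> dom T" using vw(1,2) sub(2) by blast+
  then have "p + q = (v + w, the (T (v + w)))" using vw(3,4) linear_op_add[OF lin] by simp
  then show "p + q \<in> (\<lambda>v. (v, the (T v))) ` D"
    by (rule image_eqI) (rule subspace_add[OF sub(1) vw(1,2)])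
next
  fix c p assume "p \<in> (\<lambda>v. (v, the (T v))) ` D"
  then obtain v where v: "v \<in> D" "p = (v, the (T v))" by blast
  have "v \<in> dom T" using v(1) sub(2) by blast
  then have "c *\<^sub>R p = (c *\<^sub>R v, the (T (c *\<^sub>R v)))" using v(2) linear_op_scaleR[OF lin] by simp
  then show "c *\<^sub>R p \<in> (\<lambda>v. (v, the (T v))) ` D"
    by (rule image_eqI) (rule subspace_scale[OF sub(1) v(1)])
qed

lemma graph_eq_image: "Map.graph T = (\<lambda>v. (v, the (T v))) ` dom T"
  proof -
  have "T a = Some b \<longleftrightarrow> a \<in> dom T \<and> b = the (T a)" for a b by (auto simp: domIff)
  then show ?thesis by (auto simp: graph_def)
qed

text \<open>
  Von Neumann's argument: project \<open>(h, 0)\<close> orthogonally to the graph of \<open>T\<close>. If the projection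
  is \<open>(x, T x)\<close>, then orthogonality of the difference to all \<open>(u, T u)\<close> says precisely that
  \<open>T x\<close> lies in the domain of the adjoint and that \<open>T* T x = h - x\<close>.
\<close>

theorem represents_form_adjoint_comp:
  fixes T :: "'a::chilbert_space operator"
  assumes lin: "linear_op T" and dense: "densely_defined T" and cl: "closed_op T"
  shows "represents_form (op_adjoint T \<circ>\<^sub>m T) T"
  unfolding represents_form_def
proof (intro conjI ballI allI)
  show "linear_op (op_adjoint T \<circ>\<^sub>m T)"
    by (rule linear_op_comp[OF linear_op_adjoint[OF lin dense] lin])
  show "dom (op_adjoint T \<circ>\<^sub>m T) \<subseteq> dom T" by (auto simp: in_dom_map_comp)
  show "inner (the (T x)) (the (T v)) = inner x (the ((op_adjoint T \<circ>\<^sub>m T) v))"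
    if "x \<in> dom T" "v \<in> dom (op_adjoint T \<circ>\<^sub>m T)" for x v
    using that op_adjoint_inner[OF lin dense] by (simp add: in_dom_map_comp the_map_comp)
  show "\<exists>v\<in>dom (op_adjoint T \<circ>\<^sub>m T). v + the ((op_adjoint T \<circ>\<^sub>m T) v) = h" for h
  proof -
    have "subspace (Map.graph T)" "closed (Map.graph T)"
      using subspace_graph_on[OF lin linear_op_subspace[OF lin]] cl
      by (auto simp: graph_eq_image closed_op_def)
    then obtain p where p: "p \<in> Map.graph T" "\<forall>q\<in>Map.graph T. inner ((h, 0) - p) q = 0"
      using orthogonal_projection_exists by blast
    then obtain x where x: "x \<in> dom T" "p = (x, the (T x))" by (auto simp: graph_eq_image)
    have "inner (the (T u)) (the (T x)) = inner u (h - x)" if "u \<in> dom T" for u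
    proof -
      have "inner ((h, 0) - p) (u, the (T u)) = 0" using p(2) that by (auto simp: graph_eq_image)
      then show ?thesis by (simp add: x(2) inner_commute)
    qed
    then have adj: "op_adjoint T (the (T x)) = Some (h - x)"
      by (simp add: op_adjoint_eq_Some[OF lin dense])
    then have "x \<in> dom (op_adjoint T \<circ>\<^sub>m T)" using x(1) by (auto simp: in_dom_map_comp intro: domI)
    moreover have "x + the ((op_adjoint T \<circ>\<^sub>m T) x) = h" using adj x(1) by (simp add: the_map_comp)
    ultimately show ?thesis by blast
  qed
qed (fact lin cl)+

text \<open>
  \<open>dom S\<close> is a core for \<open>T\<close>. If \<open>(d, T d)\<close> is orthogonal to all \<open>(v, T v)\<close> with \<open>v \<in> dom S\<close>, then
  \<open>d\<close> is orthogonal to all \<open>v + S v\<close>, that is, to the whole space.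
\<close>

lemma represents_form_core:
  fixes S T :: "'a::chilbert_space operator"
  assumes rep: "represents_form S T" and x: "x \<in> dom T"
  shows "(x, the (T x)) \<in> closure ((\<lambda>v. (v, the (T v))) ` dom S)"
proof -
  note r = represents_formD[OF rep]
  let ?N = "closure ((\<lambda>v. (v, the (T v))) ` dom S)"
  have N: "?N \<subseteq> Map.graph T"
    using r(3,4) by (intro closure_minimal) (auto simp: closed_op_def graph_eq_image)
  have "subspace ?N" by (intro subspace_closure subspace_graph_on r linear_op_subspace)
  then obtain p where p: "p \<in> ?N" "\<forall>q\<in>?N. inner ((x, the (T x)) - p) q = 0"
    using orthogonal_projection_exists closed_closure by blast
  then obtain m where m: "m \<in> dom T" "p = (m, the (T m))" using N by (auto simp: graph_eq_image)
  obtain v where v: "v \<in> dom S" "v + the (S v) = x - m" using r(6) by blast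
  have "(v, the (T v)) \<in> ?N" using v(1) by (intro subsetD[OF closure_subset] imageI)
  then have "inner ((x, the (T x)) - p) (v, the (T v)) = 0" using p(2) by blast
  then have "inner (x - m) v + inner (the (T x) - the (T m)) (the (T v)) = 0" by (simp add: m(2))
  moreover have "inner (the (T x) - the (T m)) (the (T v)) = inner (x - m) (the (S v))"
    using r(5)[OF linear_op_diff_dom[OF r(2) x m(1)] v(1)] linear_op_diff[OF r(2) x m(1)] by simp
  ultimately have "inner (x - m) (v + the (S v)) = 0" by (simp add: inner_add_right)
  then have "x = m" using v(2) by simp
  then show ?thesis using p(1) m by simp
qed

text \<open>
  On \<open>dom S\<close> both \<open>|T v|^2\<close> and \<open>|U v|^2\<close> equal \<open>\<langle>v, S v\<rangle>\<close>. As \<open>dom S\<close> is a core for \<open>T\<close> and \<open>U\<close> is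
  closed, an approximation of \<open>(x, T x)\<close> along the core also makes the values of \<open>U\<close> converge.
\<close>

lemma represents_form_transfer:
  fixes S T U :: "'a::chilbert_space operator"
  assumes rT: "represents_form S T" and rU: "represents_form S U" and x: "x \<in> dom T"
  shows "x \<in> dom U \<and> norm (the (U x)) = norm (the (T x))"
proof -
  note T = represents_formD[OF rT] and U = represents_formD[OF rU]
  have eq: "norm (the (U v)) = norm (the (T v))" if "v \<in> dom S" for v
    using represents_form_norm[OF rT that] represents_form_norm[OF rU that]
    by (metis norm_ge_zero power2_eq_iff_nonneg)
  obtain p where p: "\<And>n. p n \<in> (\<lambda>v. (v, the (T v))) ` dom S" "p \<longlonglongrightarrow> (x, the (T x))"
    using represents_form_core[OF rT x] by (auto simp: closure_sequential)
  define v where "v n = fst (p n)" for n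
  have v: "v n \<in> dom S" and pv: "p n = (v n, the (T (v n)))" for n
    using p(1)[of n] by (auto simp: v_def)
  have lim1: "v \<longlonglongrightarrow> x" using tendsto_fst[OF p(2)] by (simp add: v_def[abs_def])
  have lim2: "(\<lambda>n. the (T (v n))) \<longlonglongrightarrow> the (T x)" using tendsto_snd[OF p(2)] by (simp add: pv)
  have "dist (the (U (v m))) (the (U (v n))) = dist (the (T (v m))) (the (T (v n)))" for m n
  proof -
    have d: "v k \<in> dom T" "v k \<in> dom U" for k using v T(4) U(4) by blast+
    show ?thesis
      using eq[OF linear_op_diff_dom[OF T(1) v v], of m n]
      by (simp add: linear_op_diff[OF T(2) d(1) d(1)] linear_op_diff[OF U(2) d(2) d(2)] dist_norm)
  qed
  then have "Cauchy (\<lambda>n. the (U (v n)))"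
    using LIMSEQ_imp_Cauchy[OF lim2] by (simp add: Cauchy_def)
  then obtain w where w: "(\<lambda>n. the (U (v n))) \<longlonglongrightarrow> w" using Cauchy_convergent convergentD by blast
  have Ux: "U x = Some w" using U(4) v by (intro closed_op_limit[OF U(3) _ lim1 w]) auto
  have "(\<lambda>n. norm (the (T (v n)))) \<longlonglongrightarrow> norm w" using tendsto_norm[OF w] by (simp add: eq v)
  moreover have "(\<lambda>n. norm (the (T (v n)))) \<longlonglongrightarrow> norm (the (T x))" by (rule tendsto_norm[OF lim2])
  ultimately have "norm w = norm (the (T x))" by (rule LIMSEQ_unique)
  then show ?thesis using Ux by (auto intro: domI)
qed

corollary represents_form_same_dom_norm:
  fixes S T U :: "'a::chilbert_space operator"
  assumes "represents_form S T" and "represents_form S U"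
  shows "dom T = dom U" and "\<And>x. x \<in> dom T \<Longrightarrow> norm (the (T x)) = norm (the (U x))"
proof -
  show "dom T = dom U"
    using represents_form_transfer[OF assms] represents_form_transfer[OF assms(2,1)] by blast
  show "norm (the (T x)) = norm (the (U x))" if "x \<in> dom T" for x
    using represents_form_transfer[OF assms that] by simp
qed

section \<open>Resolvents\<close>

text \<open>
  From \<open>|P x + e x| \<ge> e |x|\<close> the range is closed, and it is dense because a vector orthogonal to it
  would be an eigenvector of \<open>P\<close> for the negative number \<open>-e\<close>.
\<close>

lemma resolvent_surj:
  fixes P :: "'a::chilbert_space operator"
  assumes sa: "self_adjoint_op P" and pos: "\<forall>x\<in>dom P. 0 \<le> inner (the (P x)) x" and e: "e > 0"
  shows "\<exists>x\<in>dom P. the (P x) + e *\<^sub>R x = h"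
proof -
  have lin: "linear_op P" and dense: "densely_defined P" and adj: "op_adjoint P = P"
    using sa by (rule self_adjoint_opD)+
  define f where "f x = the (P x) + e *\<^sub>R x" for x
  have f_add: "f (x + y) = f x + f y" and f_diff: "f (x - y) = f x - f y" if "x \<in> dom P" "y \<in> dom P" for x y
    using that by (simp_all add: f_def linear_op_add[OF lin] linear_op_diff[OF lin] algebra_simps)
  have f_scale: "f (c *\<^sub>R x) = c *\<^sub>R f x" if "x \<in> dom P" for x c
    using that by (simp add: f_def linear_op_scaleR[OF lin] algebra_simps)
  have lower: "e * norm x \<le> norm (f x)" if "x \<in> dom P" for x
  proof -
    have "e * norm x * norm x \<le> inner (f x) x"
      using that pos by (simp add: f_def inner_add_left power2_norm_eq_inner[symmetric] power2_eq_square)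
    also have "\<dots> \<le> norm (f x) * norm x" by (rule norm_cauchy_schwarz)
    finally show ?thesis by (cases "x = 0") auto
  qed
  have sub: "subspace (f ` dom P)"
    unfolding subspace_def
  proof (intro conjI ballI allI)
    show "0 \<in> f ` dom P" using linear_op_0[OF lin] linear_op_zero[OF lin] by (intro image_eqI[of _ _ 0]) (simp_all add: f_def)
  next
    fix x y assume "x \<in> f ` dom P" "y \<in> f ` dom P"
    then show "x + y \<in> f ` dom P" by (auto simp flip: f_add intro: linear_op_add_dom[OF lin])
  next
    fix c x assume "x \<in> f ` dom P"
    then show "c *\<^sub>R x \<in> f ` dom P" by (auto simp flip: f_scale intro: linear_op_scaleR_dom[OF lin])
  qed
  have "closure (f ` dom P) = UNIV"
  proof (rule dense_if_orthogonal_trivial[OF sub])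
    fix y assume y: "\<And>v. v \<in> f ` dom P \<Longrightarrow> inner y v = 0"
    have "inner (the (P v)) y = inner v (- e *\<^sub>R y)" if "v \<in> dom P" for v
      using y[of "f v"] that by (simp add: f_def inner_add_right inner_commute)
    then have "op_adjoint P y = Some (- e *\<^sub>R y)" by (simp add: op_adjoint_eq_Some[OF lin dense])
    then have "P y = Some (- e *\<^sub>R y)" by (simp add: adj)
    then have "0 \<le> inner (- e *\<^sub>R y) y" using bspec[OF pos domI[of P y "- e *\<^sub>R y"]] by simp
    then have "inner y y \<le> 0" using e by (simp add: mult_le_0_iff)
    then show "y = 0" using inner_ge_zero[of y] inner_eq_zero_iff[of y] by linarith
  qed
  then have "h \<in> closure (f ` dom P)" by simp
  then obtain g where "\<And>n. g n \<in> f ` dom P" and glim: "g \<longlonglongrightarrow> h" unfolding closure_sequential by blast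
  then have "\<forall>n. \<exists>u. u \<in> dom P \<and> g n = f u" by blast
  from choice[OF this] obtain x where "\<forall>n. x n \<in> dom P \<and> g n = f (x n)" by blast
  then have x: "\<And>n. x n \<in> dom P" and g: "\<And>n. g n = f (x n)" by blast+
  have "Cauchy x"
  proof (rule metric_CauchyI)
    fix d :: real assume "0 < d"
    then obtain N where N: "\<forall>m\<ge>N. \<forall>n\<ge>N. dist (g m) (g n) < e * d"
      using metric_CauchyD[OF LIMSEQ_imp_Cauchy[OF glim], of "e * d"] e by auto
    have "dist (x m) (x n) < d" if "m \<ge> N" "n \<ge> N" for m n
    proof -
      have "e * norm (x m - x n) \<le> norm (g m - g n)"
        using lower[OF linear_op_diff_dom[OF lin x x]] f_diff[OF x x] by (simp add: g)
      also have "\<dots> < e * d" using N that by (simp add: dist_norm)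
      finally show ?thesis using e by (simp add: dist_norm)
    qed
    then show "\<exists>N. \<forall>m\<ge>N. \<forall>n\<ge>N. dist (x m) (x n) < d" by blast
  qed
  then obtain y where y: "x \<longlonglongrightarrow> y" using Cauchy_convergent convergentD by blast
  have "(\<lambda>n. g n - e *\<^sub>R x n) \<longlonglongrightarrow> h - e *\<^sub>R y" by (intro tendsto_intros glim y)
  then have "(\<lambda>n. the (P (x n))) \<longlonglongrightarrow> h - e *\<^sub>R y" by (simp add: g f_def)
  then have "P y = Some (h - e *\<^sub>R y)" by (rule closed_op_limit[OF self_adjoint_closed[OF sa] x y])
  then show ?thesis by (auto intro!: bexI[of _ y] domI)
qed

section \<open>Operator monotonicity of the square root\<close>

text \<open>
  This is the Heinz inequality: \<open>Q^2 \<le> P^2\<close> implies \<open>Q \<le> P\<close>. It is proved without a functional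
  calculus, by the method of Krein and Lax for symmetrisable operators. Let \<open>f = P + e\<close> with \<open>e > 0\<close> and
  \<open>N = f^-1 Q\<close>. In the semi-inner product \<open>[u, v] = \<langle>f u, v\<rangle>\<close> the operator \<open>N\<close> is symmetric, with
  \<open>[N u, u] = \<langle>Q u, u\<rangle>\<close>. For \<open>a n = [N^n x, x]\<close> the inequality \<open>[x - N^n x, x - N^n x] \<ge> 0\<close> reads
  \<open>a n - a 0 \<le> (a (2 n) - a 0) / 2\<close>, so that \<open>a 1 - a 0 \<le> (a (2^k) - a 0) / 2^k\<close> for all \<open>k\<close>. As
  \<open>|f (N u)| = |Q u| \<le> |P u| \<le> |f u|\<close>, the sequence \<open>a\<close> is bounded above and the right-hand side has
  limit at most \<open>0\<close>. Thus \<open>\<langle>Q x, x\<rangle> = a 1 \<le> a 0 = \<langle>P x, x\<rangle> + e |x|^2\<close>.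
\<close>

theorem heinz_inequality:
  fixes P Q :: "'a::chilbert_space operator"
  assumes sa: "self_adjoint_op P" and pos: "\<forall>x\<in>dom P. 0 \<le> inner (the (P x)) x"
    and sym: "\<And>x y. x \<in> dom P \<Longrightarrow> y \<in> dom P \<Longrightarrow> inner (the (Q x)) y = inner x (the (Q y))"
    and bound: "\<And>x. x \<in> dom P \<Longrightarrow> norm (the (Q x)) \<le> norm (the (P x))"
    and x: "x \<in> dom P"
  shows "inner (the (Q x)) x \<le> inner (the (P x)) x"
proof (rule field_le_epsilon)
  fix d :: real assume d: "0 < d"
  define e where "e = d / ((norm x)\<^sup>2 + 1)"
  have e: "e > 0" using d by (simp add: e_def add_nonneg_pos)
  have ed: "e * (norm x)\<^sup>2 \<le> d"
  proof -
    have "d * (norm x)\<^sup>2 \<le> d * ((norm x)\<^sup>2 + 1)" using d by simp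
    then show ?thesis by (simp add: e_def field_simps add_pos_nonneg pos_divide_le_eq)
  qed
  have lin: "linear_op P" using sa by (rule self_adjoint_opD)
  define f where "f x = the (P x) + e *\<^sub>R x" for x
  have f_diff: "f (u - v) = f u - f v" if "u \<in> dom P" "v \<in> dom P" for u v
    using that by (simp add: f_def linear_op_diff[OF lin] algebra_simps)
  have f_sym: "inner (f u) v = inner u (f v)" if "u \<in> dom P" "v \<in> dom P" for u v
    using self_adjoint_inner[OF sa that] by (simp add: f_def inner_add_left inner_add_right)
  have f_pos: "0 \<le> inner (f u) u" if "u \<in> dom P" for u
    using that pos e by (simp add: f_def inner_add_left)
  have f_norm: "norm (the (P u)) \<le> norm (f u)" if "u \<in> dom P" for u
  proof -
    have "(norm (f u))\<^sup>2 = (norm (the (P u)))\<^sup>2 + 2 * e * inner (the (P u)) u + e\<^sup>2 * (norm u)\<^sup>2"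
      unfolding f_def power2_norm_eq_inner
      by (simp add: inner_add_left inner_add_right inner_commute[of u "the (P u)"] power2_eq_square distrib_left)
    also have "\<dots> \<ge> (norm (the (P u)))\<^sup>2" using pos that e by simp
    finally show ?thesis by simp
  qed
  have "\<forall>u. \<exists>v. v \<in> dom P \<and> f v = the (Q u)"
    using resolvent_surj[OF sa pos e] by (fastforce simp: f_def)
  then obtain N where N: "\<And>u. N u \<in> dom P" "\<And>u. f (N u) = the (Q u)" by metis
  define y where "y n = (N ^^ n) x" for n
  have y0: "y 0 = x" and ySuc: "y (Suc n) = N (y n)" for n by (simp_all add: y_def)
  have y: "y n \<in> dom P" for n by (cases n) (simp_all add: y0 ySuc x N)
  \<comment> \<open>the operator \<open>N\<close> is symmetric for the semi-inner product, so its powers move across\<close>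
  have shift: "inner (f (y m)) (y n) = inner (f (y (m + n))) x" for m n
  proof (induction n arbitrary: m)
    case (Suc n)
    have "inner (f (y m)) (y (Suc n)) = inner (y m) (the (Q (y n)))"
      unfolding f_sym[OF y y] by (simp add: ySuc N)
    also have "\<dots> = inner (f (y (Suc m))) (y n)" by (simp add: sym[OF y y, symmetric] ySuc N)
    finally show ?case using Suc.IH[of "Suc m"] by simp
  qed (simp add: y0)
  define a where "a n = inner (f (y n)) x" for n
  have "norm (f (y n)) \<le> norm (f x)" for n
  proof (induction n)
    case (Suc n)
    have "norm (f (y (Suc n))) = norm (the (Q (y n)))" by (simp add: ySuc N)
    then show ?case using bound[OF y] f_norm[OF y] Suc.IH by (metis order_trans)
  qed (simp add: y0)
  then have a_le: "a n \<le> norm (f x) * norm x" for n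
    unfolding a_def by (meson mult_right_mono norm_cauchy_schwarz norm_ge_zero order_trans)
  have a_step: "a n - a 0 \<le> (a (2 * n) - a 0) / 2" for n
  proof -
    have "0 \<le> inner (f (x - y n)) (x - y n)" by (intro f_pos linear_op_diff_dom[OF lin] x y)
    also have "\<dots> = (inner (f x) x - inner (f x) (y n)) - (inner (f (y n)) x - inner (f (y n)) (y n))"
      by (simp only: f_diff[OF x y] inner_diff_left inner_diff_right)
    also have "inner (f x) (y n) = a n" using shift[of 0 n] by (simp only: y0 a_def add_0)
    also have "inner (f (y n)) (y n) = a (2 * n)" using shift[of n n] by (simp only: a_def mult_2)
    also have "inner (f (y n)) x = a n" by (simp only: a_def)
    also have "inner (f x) x = a 0" by (simp only: a_def y0)
    finally show ?thesis by simp
  qed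
  have "a 1 - a 0 \<le> (a (2 ^ k) - a 0) / 2 ^ k" for k
  proof (induction k)
    case (Suc k)
    also have "(a (2 ^ k) - a 0) / 2 ^ k \<le> (a (2 * 2 ^ k) - a 0) / 2 / 2 ^ k"
      by (intro divide_right_mono a_step) simp
    finally show ?case by simp
  qed simp
  then have "a 1 - a 0 \<le> (norm (f x) * norm x - a 0) / 2 ^ k" for k
    using a_le[of "2 ^ k"] by (meson diff_right_mono divide_right_mono order_trans zero_le_numeral zero_le_power)
  moreover have "(\<lambda>k. (norm (f x) * norm x - a 0) / 2 ^ k) \<longlonglongrightarrow> 0"
    using LIMSEQ_divide_realpow_zero[of 2 "norm (f x) * norm x - a 0"] by simp
  ultimately have "a 1 - a 0 \<le> 0" by (intro LIMSEQ_le_const) auto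
  moreover have "a 1 = inner (the (Q x)) x" by (simp add: a_def y_def N)
  moreover have "a 0 = inner (the (P x)) x + e * (norm x)\<^sup>2"
    by (simp add: a_def y0 f_def inner_add_left power2_norm_eq_inner)
  ultimately show "inner (the (Q x)) x \<le> inner (the (P x)) x + d" using ed by simp
qed

section \<open>Square roots of bounded positive operators\<close>

text \<open>
  If \<open>Y = (X + Y^2) / 2\<close>, then \<open>(1 - Y)^2 = 1 - X\<close>. For a contraction \<open>X\<close> the iteration of this fixed
  point equation from \<open>0\<close> is dominated by the same iteration for the number \<open>1\<close>: the norms of the
  iterates and of their increments are at most those of the scalar sequence, which is
  increasing and bounded by \<open>1\<close>.
\<close>

primrec sqrt_iter :: "('b::real_vector \<Rightarrow> 'b) \<Rightarrow> nat \<Rightarrow> 'b \<Rightarrow> 'b" where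
  "sqrt_iter X 0 x = 0"
| "sqrt_iter X (Suc n) x = (1/2) *\<^sub>R (X x + sqrt_iter X n (sqrt_iter X n x))"

primrec sqrt_majorant :: "nat \<Rightarrow> real" where
  "sqrt_majorant 0 = 0"
| "sqrt_majorant (Suc n) = (1 + (sqrt_majorant n)\<^sup>2) / 2"

lemma sqrt_majorant_bounds: "0 \<le> sqrt_majorant n \<and> sqrt_majorant n \<le> 1"
  by (induction n) (auto simp: power_le_one)

lemma sqrt_majorant_increasing: "sqrt_majorant n \<le> sqrt_majorant (Suc n)"
  using zero_le_power2[of "1 - sqrt_majorant n"] by (simp add: power2_diff)

lemma convergent_sqrt_majorant: "convergent sqrt_majorant"
  using incseq_convergent[of sqrt_majorant 1] sqrt_majorant_bounds sqrt_majorant_increasing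
  by (metis convergent_def incseq_SucI)

lemma linear_sqrt_iter: "linear X \<Longrightarrow> linear (sqrt_iter X n)"
proof (induction n)
  case 0
  then show ?case by (auto intro: linearI)
next
  case (Suc n)
  have "linear (\<lambda>x. (1/2) *\<^sub>R (X x + (sqrt_iter X n \<circ> sqrt_iter X n) x))"
    by (intro linear_compose_scale_right linear_compose_add linear_compose Suc)
  then show ?case by (simp add: o_def)
qed

lemma norm_sqrt_iter:
  assumes bd: "\<And>x. norm (X x) \<le> norm (x::'b::real_normed_vector)"
  shows "norm (sqrt_iter X n x) \<le> sqrt_majorant n * norm x"
proof (induction n arbitrary: x)
  case (Suc n)
  let ?m = "sqrt_majorant n"
  have "norm (sqrt_iter X n (sqrt_iter X n x)) \<le> ?m * norm (sqrt_iter X n x)" by (rule Suc.IH)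
  also have "\<dots> \<le> ?m * (?m * norm x)" by (intro mult_left_mono Suc.IH) (simp add: sqrt_majorant_bounds)
  finally have "norm (X x + sqrt_iter X n (sqrt_iter X n x)) \<le> norm x + ?m * (?m * norm x)"
    using bd[of x] norm_triangle_ineq[of "X x" "sqrt_iter X n (sqrt_iter X n x)"] by linarith
  then show ?case
    unfolding sqrt_iter.simps sqrt_majorant.simps norm_scaleR
    by (simp add: power2_eq_square field_simps)
qed simp

lemma norm_sqrt_iter_step:
  assumes lin: "linear X" and bd: "\<And>x. norm (X x) \<le> norm (x::'b::real_normed_vector)"
  shows "norm (sqrt_iter X (Suc n) x - sqrt_iter X n x)
    \<le> (sqrt_majorant (Suc n) - sqrt_majorant n) * norm x"
proof (induction n arbitrary: x)
  case 0
  then show ?case using bd[of x] by simp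
next
  case (Suc n)
  let ?Y = "sqrt_iter X n" and ?Z = "sqrt_iter X (Suc n)"
  let ?m = "sqrt_majorant n" and ?k = "sqrt_majorant (Suc n)"
  note IH = Suc.IH
  have d: "0 \<le> ?k - ?m" using sqrt_majorant_increasing[of n] by linarith
  have "norm (?Z (?Z x) - ?Y (?Z x)) \<le> (?k - ?m) * norm (?Z x)" by (rule IH)
  also have "\<dots> \<le> (?k - ?m) * (?k * norm x)" by (intro mult_left_mono d norm_sqrt_iter bd)
  finally have 1: "norm (?Z (?Z x) - ?Y (?Z x)) \<le> (?k - ?m) * (?k * norm x)" .
  have "norm (?Y (?Z x) - ?Y (?Y x)) = norm (?Y (?Z x - ?Y x))"
    by (simp only: linear_diff[OF linear_sqrt_iter[OF lin]])
  also have "\<dots> \<le> ?m * norm (?Z x - ?Y x)" by (rule norm_sqrt_iter[OF bd])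
  also have "\<dots> \<le> ?m * ((?k - ?m) * norm x)" by (intro mult_left_mono IH) (simp add: sqrt_majorant_bounds)
  finally have 2: "norm (?Y (?Z x) - ?Y (?Y x)) \<le> ?m * ((?k - ?m) * norm x)" .
  have "sqrt_iter X (Suc (Suc n)) x - ?Z x = (1/2) *\<^sub>R (?Z (?Z x) - ?Y (?Y x))"
    unfolding sqrt_iter.simps(2)[of X "Suc n" x] sqrt_iter.simps(2)[of X n x]
    by (simp only: scaleR_diff_right[symmetric]) simp
  also have "\<dots> = (1/2) *\<^sub>R ((?Z (?Z x) - ?Y (?Z x)) + (?Y (?Z x) - ?Y (?Y x)))" by simp
  finally have "norm (sqrt_iter X (Suc (Suc n)) x - ?Z x)
      = norm ((?Z (?Z x) - ?Y (?Z x)) + (?Y (?Z x) - ?Y (?Y x))) / 2" by (simp del: sqrt_iter.simps)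
  also have "\<dots> \<le> ((?k - ?m) * (?k * norm x) + ?m * ((?k - ?m) * norm x)) / 2"
    by (intro divide_right_mono norm_triangle_le add_mono 1 2) simp
  also have "\<dots> = (?k\<^sup>2 - ?m\<^sup>2) / 2 * norm x" by (simp only: power2_eq_square) algebra
  also have "(?k\<^sup>2 - ?m\<^sup>2) / 2 = sqrt_majorant (Suc (Suc n)) - ?k"
    using sqrt_majorant.simps(2)[of "Suc n"] sqrt_majorant.simps(2)[of n] by (simp only:) (simp add: field_simps)
  finally show ?case .
qed

lemma norm_sqrt_iter_diff:
  assumes lin: "linear X" and bd: "\<And>x. norm (X x) \<le> norm (x::'b::real_normed_vector)" and "n \<le> k"
  shows "norm (sqrt_iter X k x - sqrt_iter X n x) \<le> (sqrt_majorant k - sqrt_majorant n) * norm x"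
  using \<open>n \<le> k\<close>
proof (induction k rule: dec_induct)
  case (step k)
  have "norm (sqrt_iter X (Suc k) x - sqrt_iter X n x)
      \<le> norm (sqrt_iter X (Suc k) x - sqrt_iter X k x) + norm (sqrt_iter X k x - sqrt_iter X n x)"
    by (rule norm_diff_triangle_ineq[of _ "sqrt_iter X k x" "sqrt_iter X k x", simplified])
  also have "\<dots> \<le> (sqrt_majorant (Suc k) - sqrt_majorant k) * norm x
      + (sqrt_majorant k - sqrt_majorant n) * norm x"
    by (intro add_mono step.IH norm_sqrt_iter_step lin bd)
  finally show ?case by (simp only: left_diff_distrib)
qed simp

lemma sqrt_iter_convergent:
  fixes X :: "'b::{real_normed_vector,complete_space} \<Rightarrow> 'b"
  assumes lin: "linear X" and bd: "\<And>x. norm (X x) \<le> norm x"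
  shows "convergent (\<lambda>n. sqrt_iter X n x)"
proof -
  have "Cauchy (\<lambda>n. sqrt_iter X n x)"
  proof (rule metric_CauchyI)
    fix e :: real assume e: "0 < e"
    have "Cauchy sqrt_majorant" using convergent_sqrt_majorant by (rule convergent_Cauchy)
    then obtain N where N: "\<forall>m\<ge>N. \<forall>n\<ge>N. dist (sqrt_majorant m) (sqrt_majorant n) < e / (norm x + 1)"
      using metric_CauchyD[of sqrt_majorant "e / (norm x + 1)"] e by (auto simp: add_nonneg_pos)
    have *: "dist (sqrt_iter X m x) (sqrt_iter X n x) < e" if "m \<ge> n" "n \<ge> N" for m n
    proof -
      have "norm (sqrt_iter X m x - sqrt_iter X n x) \<le> (sqrt_majorant m - sqrt_majorant n) * norm x"
        by (rule norm_sqrt_iter_diff[OF lin bd that(1)])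
      also have "\<dots> \<le> e / (norm x + 1) * norm x"
      proof (rule mult_right_mono)
        have "dist (sqrt_majorant m) (sqrt_majorant n) < e / (norm x + 1)" using N that by simp
        then show "sqrt_majorant m - sqrt_majorant n \<le> e / (norm x + 1)" by (simp add: dist_real_def)
      qed simp
      also have "\<dots> < e" using e by (simp add: divide_less_eq add_nonneg_pos)
      finally show ?thesis by (simp add: dist_norm)
    qed
    have "dist (sqrt_iter X m x) (sqrt_iter X n x) < e" if "m \<ge> N" "n \<ge> N" for m n
      using *[of n m] *[of m n] that by (cases "n \<le> m") (simp_all add: dist_commute)
    then show "\<exists>N. \<forall>m\<ge>N. \<forall>n\<ge>N. dist (sqrt_iter X m x) (sqrt_iter X n x) < e" by blast
  qed
  then show ?thesis by (rule Cauchy_convergent)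
qed

lemma sqrt_iter_commute:
  assumes "linear B" and "\<And>x. B (X x) = X (B x)"
  shows "B (sqrt_iter X n x) = sqrt_iter X n (B x)"
  by (induction n arbitrary: x)
    (simp_all add: linear_0[OF assms(1)] linear_scale[OF assms(1)] linear_add[OF assms(1)] assms(2))

lemma sqrt_iter_symmetric:
  assumes "\<And>x y. inner (X x) y = inner x (X (y::'b::real_inner))"
  shows "inner (sqrt_iter X n x) y = inner x (sqrt_iter X n y)"
  by (induction n arbitrary: x y) (simp_all add: inner_add_left inner_add_right assms)

text \<open>
  \<open>Z = 1 - Y\<close> for the limit \<open>Y\<close> of the iteration. The bound on \<open>x - Z x\<close> has two uses: by the
  Cauchy-Schwarz inequality it makes \<open>Z\<close> positive, and it allows the theorem to be applied
  again to \<open>1 - Z\<close>. The commutation property holds because it holds for every iterate.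
\<close>

theorem contraction_sqrt:
  fixes X :: "'b::{real_inner,complete_space} \<Rightarrow> 'b"
  assumes lin: "linear X" and bd: "\<And>x. norm (X x) \<le> norm x"
    and sym: "\<And>x y. inner (X x) y = inner x (X y)"
  obtains Z where "bounded_linear Z" "\<And>x y. inner (Z x) y = inner x (Z y)"
    "\<And>x. norm (x - Z x) \<le> norm x" "\<And>x. Z (Z x) = x - X x"
    "\<forall>B. bounded_linear B \<longrightarrow> (\<forall>x. B (X x) = X (B x)) \<longrightarrow> (\<forall>x. B (Z x) = Z (B x))"
proof -
  let ?Y = "sqrt_iter X"
  note linY = linear_sqrt_iter[OF lin]
  define Y where "Y x = lim (\<lambda>n. ?Y n x)" for x
  have lim: "(\<lambda>n. ?Y n x) \<longlonglongrightarrow> Y x" for x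
    unfolding Y_def using sqrt_iter_convergent[OF lin bd] by (simp add: convergent_LIMSEQ_iff)
  have contr: "norm (?Y n x) \<le> norm x" for n x
    using norm_sqrt_iter[OF bd, of n x] sqrt_majorant_bounds[of n]
    by (meson mult_left_le_one_le norm_ge_zero order_trans)
  have Ybd: "norm (Y x) \<le> norm x" for x
    using tendsto_norm[OF lim[of x]] contr by (intro LIMSEQ_le_const2) auto
  have Yadd: "Y (x + y) = Y x + Y y" for x y
    using lim[of "x + y"] tendsto_add[OF lim[of x] lim[of y]]
    by (simp add: linear_add[OF linY] LIMSEQ_unique)
  have Yscale: "Y (c *\<^sub>R x) = c *\<^sub>R Y x" for c x
    using lim[of "c *\<^sub>R x"] tendsto_scaleR[OF tendsto_const lim[of x], of c]
    by (simp add: linear_scale[OF linY] LIMSEQ_unique)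
  have Ysym: "inner (Y x) y = inner x (Y y)" for x y
    using tendsto_inner[OF lim[of x] tendsto_const[of y]] tendsto_inner[OF tendsto_const[of x] lim[of y]]
    by (simp add: sqrt_iter_symmetric[OF sym] LIMSEQ_unique)
  have lim2: "(\<lambda>n. ?Y n (?Y n x)) \<longlonglongrightarrow> Y (Y x)" for x
  proof -
    have "(\<lambda>n. ?Y n (?Y n x - Y x)) \<longlonglongrightarrow> 0"
    proof (rule tendsto_0_le[where K = 1])
      show "(\<lambda>n. ?Y n x - Y x) \<longlonglongrightarrow> 0" using lim[of x] by (simp add: LIM_zero_iff)
    qed (simp add: contr)
    from tendsto_add[OF this lim[of "Y x"]] show ?thesis by (simp add: linear_diff[OF linY])
  qed
  have fixpt: "2 *\<^sub>R Y x = X x + Y (Y x)" for x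
  proof -
    have "(\<lambda>n. 2 *\<^sub>R ?Y (Suc n) x) \<longlonglongrightarrow> 2 *\<^sub>R Y x"
      by (intro tendsto_intros LIMSEQ_Suc lim)
    moreover have "(\<lambda>n. X x + ?Y n (?Y n x)) \<longlonglongrightarrow> X x + Y (Y x)" by (intro tendsto_intros lim2)
    ultimately show ?thesis by (simp add: LIMSEQ_unique)
  qed
  show thesis
  proof (rule that[of "\<lambda>x. x - Y x"])
    show "bounded_linear (\<lambda>x. x - Y x)"
      by (intro bounded_linear_sub bounded_linear_ident bounded_linear_intro[where K = 1])
        (simp_all add: Yadd Yscale Ybd)
    show "inner (x - Y x) y = inner x (y - Y y)" for x y
      by (simp add: inner_diff_left inner_diff_right Ysym)
    show "norm (x - (x - Y x)) \<le> norm x" for x by (simp add: Ybd)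
    show "(x - Y x) - Y (x - Y x) = x - X x" for x
    proof -
      have "Y (x - Y x) = Y x - Y (Y x)"
        using Yadd[of x "(-1) *\<^sub>R Y x"] Yscale[of "-1" "Y x"] by simp
      then have "(x - Y x) - Y (x - Y x) = x - (2 *\<^sub>R Y x - Y (Y x))" by (simp add: scaleR_2)
      then show ?thesis by (simp add: fixpt)
    qed
    show "\<forall>B. bounded_linear B \<longrightarrow> (\<forall>x. B (X x) = X (B x)) \<longrightarrow> (\<forall>x. B (x - Y x) = B x - Y (B x))"
    proof (intro allI impI)
      fix B :: "'b \<Rightarrow> 'b" and x
      assume B: "bounded_linear B" and comm: "\<forall>x. B (X x) = X (B x)"
      have "(\<lambda>n. ?Y n (B x)) \<longlonglongrightarrow> B (Y x)"
        using bounded_linear.tendsto[OF B lim[of x]]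
        by (simp add: sqrt_iter_commute[of B X, OF bounded_linear.linear[OF B]] comm)
      then have "B (Y x) = Y (B x)" using lim[of "B x"] by (rule LIMSEQ_unique)
      then show "B (x - Y x) = B x - Y (B x)"
        by (simp add: linear_diff[OF bounded_linear.linear[OF B]])
    qed
  qed
qed

section \<open>Positive self-adjoint square roots\<close>

lemma operator_eq_if_Some_iff:
  assumes "\<And>x z. T x = Some z \<longleftrightarrow> U x = Some z"
  shows "T = U"
proof
  fix x
  show "T x = U x"
  proof (cases "T x")
    case None
    then show ?thesis using assms[of x "the (U x)"] by (cases "U x") simp_all
  next
    case (Some z)
    then show ?thesis using assms[of x z] by simp
  qed
qed

text \<open>
  Let \<open>J = (1 + S)^-1\<close>. Both \<open>J\<close> and \<open>1 - J\<close> are symmetric contractions, so there are bounded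
  positive \<open>W\<close> and \<open>V\<close> with \<open>W^2 = J\<close> and \<open>V^2 = 1 - J = S J\<close>. The square root is \<open>R = V W^-1\<close>, whose
  graph is \<open>{(W u, V u)}\<close>. Since \<open>V\<close> and \<open>W\<close> commute and \<open>W^2 + V^2 = 1\<close>, the point \<open>(y, z)\<close> lies
  on this graph, with \<open>u = W y + V z\<close>, as soon as \<open>V y = W z\<close>, and \<open>V y = W z\<close> is the condition that
  \<open>(y, z)\<close> lies on the graph of the adjoint. Complex linearity of \<open>V\<close> and \<open>W\<close> is an instance of the
  commutation property, because complex scalars commute with \<open>J\<close>.
\<close>

theorem positive_sqrt_exists:
  fixes S :: "'a::chilbert_space operator"
  assumes lin: "linear_op S"
    and sym: "\<And>v w. v \<in> dom S \<Longrightarrow> w \<in> dom S \<Longrightarrow> inner (the (S v)) w = inner v (the (S w))"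
    and pos: "\<And>v. v \<in> dom S \<Longrightarrow> 0 \<le> inner (the (S v)) v"
    and surj: "\<And>h. \<exists>v\<in>dom S. v + the (S v) = h"
  shows "\<exists>R. self_adjoint_op R \<and> positive_op R \<and> R \<circ>\<^sub>m R = S"
proof -
  have "\<forall>h. \<exists>v. v \<in> dom S \<and> v + the (S v) = h" using surj by blast
  from choice[OF this] obtain J where "\<forall>h. J h \<in> dom S \<and> J h + the (S (J h)) = h" by blast
  then have Jdom: "J h \<in> dom S" and J: "J h + the (S (J h)) = h" for h by blast+
  have SJ: "the (S (J h)) = h - J h" for h using J[of h] by (simp add: eq_diff_eq add.commute)
  have norm_sum: "(norm v)\<^sup>2 \<le> (norm (v + the (S v)))\<^sup>2 \<and>
      (norm (the (S v)))\<^sup>2 \<le> (norm (v + the (S v)))\<^sup>2" if "v \<in> dom S" for v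
  proof -
    have "(norm (v + the (S v)))\<^sup>2 = (norm v)\<^sup>2 + 2 * inner (the (S v)) v + (norm (the (S v)))\<^sup>2"
      by (simp add: power2_norm_eq_inner inner_add_left inner_add_right inner_commute[of v "the (S v)"])
    then show ?thesis using pos[OF that] by simp
  qed
  have J_unique: "v = J h" if v: "v \<in> dom S" "v + the (S v) = h" for v h
  proof -
    have "(v - J h) + the (S (v - J h)) = 0"
      using v(2) J[of h] by (simp add: linear_op_diff[OF lin v(1) Jdom] algebra_simps)
    then have "(norm (v - J h))\<^sup>2 \<le> 0"
      using norm_sum[OF linear_op_diff_dom[OF lin v(1) Jdom[of h]]] by simp
    then show ?thesis by simp
  qed
  have J_add: "J (g + h) = J g + J h" for g h
    by (rule J_unique[symmetric])
      (simp_all add: linear_op_add_dom[OF lin] linear_op_add[OF lin] Jdom SJ)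
  have J_scaleC: "J (c *\<^sub>C h) = c *\<^sub>C J h" for c h
  proof (rule J_unique[symmetric])
    show "c *\<^sub>C J h + the (S (c *\<^sub>C J h)) = c *\<^sub>C h"
      using J[of h] by (simp add: linear_op_scaleC[OF lin Jdom] flip: scaleC_add_right)
  qed (rule linear_op_scaleC_dom[OF lin Jdom])
  have J_scaleR: "J (r *\<^sub>R h) = r *\<^sub>R J h" for r h
    using J_scaleC[of "complex_of_real r" h] by (simp only: scaleC_of_real)
  have J_norm: "norm (J h) \<le> norm h" and J_norm': "norm (h - J h) \<le> norm h" for h
    using norm_sum[OF Jdom[of h]] by (simp_all add: J SJ)
  have J_sym: "inner (J g) h = inner g (J h)" for g h
    using sym[OF Jdom[of g] Jdom[of h]] by (simp add: SJ inner_diff_left inner_diff_right)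
  have J_inj: "h = 0" if "J h = 0" for h
    using J[of h] that linear_op_zero[OF lin] by simp
  have J_bl: "bounded_linear J"
    by (rule bounded_linear_intro[where K = 1]) (simp_all add: J_add J_scaleR J_norm)
  have J_lin: "linear J" by (rule bounded_linear.linear[OF J_bl])
  have I_J_lin: "linear (\<lambda>x. x - J x)"
    by (intro bounded_linear.linear bounded_linear_sub bounded_linear_ident J_bl)
  obtain V where V: "bounded_linear V" "\<And>x y. inner (V x) y = inner x (V y)"
    "\<And>x. norm (x - V x) \<le> norm x" "\<And>x. V (V x) = x - J x"
    "\<forall>B. bounded_linear B \<longrightarrow> (\<forall>x. B (J x) = J (B x)) \<longrightarrow> (\<forall>x. B (V x) = V (B x))"
    by (rule contraction_sqrt[OF J_lin J_norm J_sym]) (rule that)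
  have I_J_sym: "inner (x - J x) y = inner x (y - J y)" for x y
    by (simp add: inner_diff_left inner_diff_right J_sym)
  obtain W where W: "bounded_linear W" "\<And>x y. inner (W x) y = inner x (W y)"
    "\<And>x. norm (x - W x) \<le> norm x" "\<And>x. W (W x) = x - (x - J x)"
    "\<forall>B. bounded_linear B \<longrightarrow> (\<forall>x. B (x - J x) = B x - J (B x)) \<longrightarrow> (\<forall>x. B (W x) = W (B x))"
    by (rule contraction_sqrt[OF I_J_lin J_norm' I_J_sym]) (rule that)
  have I_W_lin: "linear (\<lambda>x. x - W x)"
    by (intro bounded_linear.linear bounded_linear_sub bounded_linear_ident W)
  have I_W_sym: "inner (x - W x) y = inner x (y - W y)" for x y
    by (simp add: inner_diff_left inner_diff_right W(2))
  \<comment> \<open>\<open>w\<close> is a square root of \<open>W\<close>; it shows that \<open>V W = w V w\<close> is positive\<close>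
  obtain w where "bounded_linear w" and w1: "\<And>x y. inner (w x) y = inner x (w y)"
    and "\<And>x. norm (x - w x) \<le> norm x" and w2: "\<And>x. w (w x) = x - (x - W x)"
    and w3: "\<forall>B. bounded_linear B \<longrightarrow> (\<forall>x. B (x - W x) = B x - W (B x)) \<longrightarrow> (\<forall>x. B (w x) = w (B x))"
    by (rule contraction_sqrt[OF I_W_lin W(3) I_W_sym]) (rule that)
  note diff = linear_diff[OF bounded_linear.linear]
  have JV: "J (V x) = V (J x)" for x by (rule V(5)[rule_format, OF J_bl]) simp
  have VW: "V (W x) = W (V x)" for x by (rule W(5)[rule_format, OF V(1)]) (simp add: diff[OF V(1)] JV)
  have Vw: "V (w x) = w (V x)" for x by (rule w3[rule_format, OF V(1)]) (simp add: diff[OF V(1)] VW)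
  have cV: "c *\<^sub>C V x = V (c *\<^sub>C x)" for c x
    by (rule V(5)[rule_format, OF bounded_linear_scaleC]) (simp add: J_scaleC)
  have cW: "c *\<^sub>C W x = W (c *\<^sub>C x)" for c x
    by (rule W(5)[rule_format, OF bounded_linear_scaleC]) (simp add: J_scaleC diff[OF bounded_linear_scaleC])
  have WW: "W (W x) = J x" for x using W(4) by simp
  have sum: "W (W x) + V (V x) = x" for x by (simp add: WW V(4))
  have W0: "x = 0" if "W x = 0" for x
    using that J_inj WW[of x] linear_0[OF bounded_linear.linear[OF W(1)]] by simp
  have W_inj: "inj W"
    using W0 by (auto simp: linear_injective_0[OF bounded_linear.linear[OF W(1)]])
  have V_pos: "0 \<le> inner (V x) x" for x
  proof -
    have "inner (x - V x) x \<le> norm x * norm x"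
      by (meson V(3) mult_right_mono norm_cauchy_schwarz norm_ge_zero order_trans)
    then show ?thesis by (simp add: inner_diff_left power2_norm_eq_inner[symmetric] power2_eq_square)
  qed
  define R where "R x = (if x \<in> range W then Some (V (inv W x)) else None)" for x
  have domR: "dom R = range W" by (auto simp: R_def domIff split: if_splits)
  have RW: "R (W u) = Some (V u)" for u by (simp add: R_def inv_f_f[OF W_inj])
  have R_eq: "R x = Some z \<longleftrightarrow> (\<exists>u. x = W u \<and> z = V u)" for x z
  proof
    assume Rx: "R x = Some z"
    then obtain u where "x = W u" by (auto simp: R_def split: if_splits)
    then show "\<exists>u. x = W u \<and> z = V u" using Rx RW[of u] by auto
  qed (auto simp: RW)
  have add: "W x + W y = W (x + y)" "V x + V y = V (x + y)" for x y
    by (simp_all add: linear_add[OF bounded_linear.linear] V(1) W(1))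
  have R_lin: "linear_op R"
  proof (rule linear_opI)
    show "0 \<in> dom R"
      unfolding domR using linear_0[OF bounded_linear.linear[OF W(1)]] by (intro image_eqI[of _ _ 0]) simp_all
    fix x assume "x \<in> dom R"
    then obtain u where u: "x = W u" by (auto simp: domR)
    show "R (c *\<^sub>C x) = Some (c *\<^sub>C the (R x))" for c
      by (simp add: u cW cV RW)
    show "R (x + y) = Some (the (R x) + the (R y))" if y: "y \<in> dom R" for y
    proof -
      obtain v where v: "y = W v" using y by (auto simp: domR)
      show ?thesis by (simp add: u v RW add)
    qed
  qed
  have R_dense: "densely_defined R"
    unfolding densely_defined_def domR
  proof (rule dense_if_orthogonal_trivial)
    show "subspace (range W)"
      by (intro linear_subspace_image bounded_linear.linear W(1)) simp
    fix y assume "\<And>v. v \<in> range W \<Longrightarrow> inner y v = 0"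
    then have "inner y (W (W y)) = 0" by blast
    then have "inner (W y) (W y) = 0" by (simp add: W(2))
    then show "y = 0" using W0 by simp
  qed
  have R_adj: "op_adjoint R y = Some z \<longleftrightarrow> R y = Some z" for y z
  proof -
    have "op_adjoint R y = Some z \<longleftrightarrow> (\<forall>u. inner u (V y) = inner u (W z))"
      by (simp add: op_adjoint_eq_Some[OF R_lin R_dense] domR RW V(2) W(2))
    also have "\<dots> \<longleftrightarrow> V y = W z" by (rule vector_eq_ldot)
    also have "\<dots> \<longleftrightarrow> R y = Some z"
    proof
      assume eq: "V y = W z"
      have "W (W y + V z) = y" using sum[of y] by (simp add: eq add[symmetric] VW[symmetric])
      moreover have "V (W y + V z) = z" using sum[of z] by (simp add: eq add[symmetric] VW)
      ultimately show "R y = Some z" unfolding R_eq by (intro exI[of _ "W y + V z"]) simp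
    next
      assume "R y = Some z"
      then show "V y = W z" unfolding R_eq by (auto simp: VW)
    qed
    finally show ?thesis .
  qed
  have "R = op_adjoint R" by (rule operator_eq_if_Some_iff) (simp add: R_adj)
  then have R_sa: "self_adjoint_op R" using R_lin R_dense by (simp add: self_adjoint_op_def)
  have "0 \<le> inner (the (R x)) x" if x: "x \<in> dom R" for x
  proof -
    obtain u where u: "x = W u" using x by (auto simp: domR)
    have "inner (V u) (W u) = inner (V u) (w (w u))" by (simp add: w2)
    also have "\<dots> = inner (V (w u)) (w u)" by (simp add: w1[symmetric] Vw)
    finally show ?thesis using V_pos[of "w u"] by (simp add: u RW)
  qed
  then have R_pos: "positive_op R" by (simp add: positive_op_iff_inner[OF R_sa])
  have "(R \<circ>\<^sub>m R) x = Some z \<longleftrightarrow> S x = Some z" for x z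
  proof
    assume "(R \<circ>\<^sub>m R) x = Some z"
    then obtain y where "R x = Some y" "R y = Some z" by (auto simp: map_comp_Some_iff)
    then obtain u t where u: "x = W u" "y = V u" and t: "y = W t" "z = V t" by (auto simp: R_eq)
    have "u = W (W u + V t)"
      using sum[of u] u(2) t(1) by (simp add: add[symmetric] VW[symmetric])
    then have x: "x = J (W u + V t)" using WW[of "W u + V t"] u(1) by simp
    have "the (S x) = z" using SJ[of "W u + V t"] by (simp add: x[symmetric]) (simp add: u(1) t(2))
    moreover have "x \<in> dom S" unfolding x by (rule Jdom)
    ultimately show "S x = Some z" by (auto simp: domIff)
  next
    assume S: "S x = Some z"
    define q where "q = x + z"
    have x: "x = J q" by (rule J_unique) (simp_all add: S q_def domI)
    have "x = W (W q)" by (simp add: WW x)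
    then have "R x = Some (W (V q))" by (simp add: RW VW)
    moreover have "V (V q) = z" by (simp add: V(4) x[symmetric]) (simp add: q_def)
    ultimately show "(R \<circ>\<^sub>m R) x = Some z" using RW[of "V q"] by (simp add: map_comp_Some_iff)
  qed
  then have "R \<circ>\<^sub>m R = S" by (rule operator_eq_if_Some_iff)
  with R_sa R_pos show ?thesis by blast
qed

text \<open>
  Polarisation: the forms of \<open>P\<close> and \<open>Q\<close> agree on a dense subspace.
\<close>

lemma symmetric_forms_eq:
  fixes P Q :: "'a::complex_inner operator"
  assumes lin: "linear_op P" "linear_op Q" and dense: "densely_defined P" and sub: "dom P \<subseteq> dom Q"
    and symP: "\<And>x y. x \<in> dom P \<Longrightarrow> y \<in> dom P \<Longrightarrow> inner (the (P x)) y = inner x (the (P y))"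
    and symQ: "\<And>x y. x \<in> dom P \<Longrightarrow> y \<in> dom P \<Longrightarrow> inner (the (Q x)) y = inner x (the (Q y))"
    and eq: "\<And>x. x \<in> dom P \<Longrightarrow> inner (the (P x)) x = inner (the (Q x)) x"
    and x: "x \<in> dom P"
  shows "the (P x) = the (Q x)"
proof -
  have "inner (the (P x) - the (Q x)) y = 0" if y: "y \<in> dom P" for y
  proof -
    have Q: "x \<in> dom Q" "y \<in> dom Q" using x y sub by blast+
    have "inner (the (P y)) x = inner (the (P x)) y" "inner (the (Q y)) x = inner (the (Q x)) y"
      using symP[OF y x] symQ[OF y x] by (simp_all add: inner_commute)
    then show ?thesis
      using eq[OF linear_op_add_dom[OF lin(1) x y]] eq[OF x] eq[OF y]
      by (simp add: linear_op_add[OF lin(1) x y] linear_op_add[OF lin(2) Q]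
          inner_add_left inner_add_right inner_diff_left)
  qed
  then have "the (P x) - the (Q x) = 0"
    using dense by (intro orthogonal_to_dense[of "dom P"]) (simp_all add: densely_defined_def)
  then show ?thesis by simp
qed

text \<open>
  Two square roots have the same square, hence the same domain and the same norms
  \<open>|P x| = |Q x|\<close>. The Heinz inequality in both directions yields \<open>\<langle>P x, x\<rangle> = \<langle>Q x, x\<rangle>\<close>.
\<close>

theorem positive_sqrt_unique:
  fixes P Q :: "'a::chilbert_space operator"
  assumes P: "self_adjoint_op P" "positive_op P" and Q: "self_adjoint_op Q" "positive_op Q"
    and eq: "P \<circ>\<^sub>m P = Q \<circ>\<^sub>m Q"
  shows "P = Q"
proof -
  have rep: "represents_form (T \<circ>\<^sub>m T) T" if "self_adjoint_op T" for T :: "'a operator"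
    using represents_form_adjoint_comp[OF self_adjoint_opD(1,2)[OF that] self_adjoint_closed[OF that]]
    by (simp only: self_adjoint_opD(3)[OF that])
  note same = represents_form_same_dom_norm[OF rep[OF P(1)] rep[OF Q(1), folded eq]]
  note pos = P(2)[unfolded positive_op_iff_inner[OF P(1)]] Q(2)[unfolded positive_op_iff_inner[OF Q(1)]]
  have symP: "inner (the (P x)) y = inner x (the (P y))"
    and symQ: "inner (the (Q x)) y = inner x (the (Q y))" if "x \<in> dom P" "y \<in> dom P" for x y
    using that self_adjoint_inner[OF P(1), of x y] self_adjoint_inner[OF Q(1), of x y] same(1)
    by simp_all
  show ?thesis
  proof (rule operator_eqI[OF same(1)])
    fix x assume x: "x \<in> dom P"
    have "inner (the (P u)) u = inner (the (Q u)) u" if u: "u \<in> dom P" for u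
    proof (rule antisym)
      show "inner (the (Q u)) u \<le> inner (the (P u)) u"
        by (rule heinz_inequality[OF P(1) pos(1) symQ _ u]) (simp_all add: same(2))
      show "inner (the (P u)) u \<le> inner (the (Q u)) u"
        by (rule heinz_inequality[OF Q(1) pos(2)]) (use u same symP in simp_all)
    qed
    then show "the (P x) = the (Q x)"
      by (intro symmetric_forms_eq[OF _ _ _ _ symP symQ _ x]) (simp_all add: self_adjoint_opD P Q same(1))
  qed
qed

lemma op_sqrt_properties:
  fixes S :: "'a::chilbert_space operator"
  assumes "linear_op S"
    and "\<And>v w. v \<in> dom S \<Longrightarrow> w \<in> dom S \<Longrightarrow> inner (the (S v)) w = inner v (the (S w))"
    and "\<And>v. v \<in> dom S \<Longrightarrow> 0 \<le> inner (the (S v)) v"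
    and "\<And>h. \<exists>v\<in>dom S. v + the (S v) = h"
  shows "self_adjoint_op (op_sqrt S)" and "positive_op (op_sqrt S)" and "op_sqrt S \<circ>\<^sub>m op_sqrt S = S"
proof -
  have "\<exists>!R. self_adjoint_op R \<and> positive_op R \<and> R \<circ>\<^sub>m R = S"
  proof (rule ex_ex1I[OF positive_sqrt_exists[OF assms]])
    fix P Q
    assume P: "self_adjoint_op P \<and> positive_op P \<and> P \<circ>\<^sub>m P = S"
      and Q: "self_adjoint_op Q \<and> positive_op Q \<and> Q \<circ>\<^sub>m Q = S"
    show "P = Q" by (rule positive_sqrt_unique) (use P Q in simp_all)
  qed
  from theI'[OF this]
  show "self_adjoint_op (op_sqrt S)" "positive_op (op_sqrt S)" "op_sqrt S \<circ>\<^sub>m op_sqrt S = S"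
    unfolding op_sqrt_def by blast+
qed

text \<open>
  Since \<open>|T|^2 = T* T\<close>, the operator \<open>T* T\<close> represents the forms of both \<open>T\<close> and \<open>|T|\<close>.
\<close>

lemma op_abs_properties:
  fixes T :: "'a::chilbert_space operator"
  assumes "linear_op T" and "densely_defined T" and "closed_op T"
  shows "self_adjoint_op (op_abs T)" and "positive_op (op_abs T)" and "dom (op_abs T) = dom T"
    and "\<And>x. x \<in> dom T \<Longrightarrow> norm (the (op_abs T x)) = norm (the (T x))"
proof -
  let ?S = "op_adjoint T \<circ>\<^sub>m T" and ?P = "op_abs T"
  have rep: "represents_form ?S T" by (rule represents_form_adjoint_comp[OF assms])
  have "0 \<le> inner (the (?S v)) v" if "v \<in> dom ?S" for v
    using zero_le_power2[of "norm (the (T v))"]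
    unfolding represents_form_norm[OF rep that] inner_commute[of v] .
  note P = op_sqrt_properties[OF represents_formD(1)[OF rep] represents_form_symmetric[OF rep] this
      represents_formD(6)[OF rep], folded op_abs_def]
  show sa: "self_adjoint_op ?P" and "positive_op ?P" using P by auto
  have "represents_form (op_adjoint ?P \<circ>\<^sub>m ?P) ?P"
    by (intro represents_form_adjoint_comp self_adjoint_closed self_adjoint_opD sa)
  then have rep': "represents_form ?S ?P" by (simp only: self_adjoint_opD(3)[OF sa] P(3))
  show "dom ?P = dom T" by (rule represents_form_same_dom_norm(1)[OF rep' rep])
  show "norm (the (?P x)) = norm (the (T x))" if "x \<in> dom T" for x
    using represents_form_same_dom_norm(2)[OF rep rep' that] by simp
qed

lemma op_sqrt_form:
  fixes P :: "'a::chilbert_space operator"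
  assumes sa: "self_adjoint_op P" and pos: "positive_op P" and x: "x \<in> dom P"
  shows "x \<in> dom (op_sqrt P)" and "(norm (the (op_sqrt P x)))\<^sup>2 = inner (the (P x)) x"
proof -
  have pos': "\<forall>v\<in>dom P. 0 \<le> inner (the (P v)) v" using pos by (simp add: positive_op_iff_inner[OF sa])
  have lin: "linear_op P" by (rule self_adjoint_opD(1)[OF sa])
  have "\<exists>v\<in>dom P. v + the (P v) = h" for h
    using resolvent_surj[OF sa pos', of 1 h] by (simp add: add.commute)
  note p = op_sqrt_properties[OF lin self_adjoint_inner[OF sa] bspec[OF pos'] this]
  have "x \<in> dom (op_sqrt P \<circ>\<^sub>m op_sqrt P)" using x by (simp only: p(3))
  then have d: "x \<in> dom (op_sqrt P)" "the (op_sqrt P x) \<in> dom (op_sqrt P)"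
    by (simp_all add: in_dom_map_comp)
  show "x \<in> dom (op_sqrt P)" by (rule d(1))
  have "the (P x) = the (op_sqrt P (the (op_sqrt P x)))" using the_map_comp[OF d(1), of "op_sqrt P"] by (simp only: p(3))
  then show "(norm (the (op_sqrt P x)))\<^sup>2 = inner (the (P x)) x"
    using self_adjoint_inner[OF p(1) d(2,1)] by (simp add: power2_norm_eq_inner)
qed

section \<open>Normal operators and the closure of the real part\<close>

text \<open>
  Symmetry passes to the closure of the graph in the weak form \<open>\<langle>y, v\<rangle> = \<langle>x, T v\<rangle>\<close>, which
  determines \<open>y\<close> from \<open>x\<close> because the domain is dense. So the closure of the graph is again a graph.
\<close>

lemma op_closure_symmetric:
  fixes T :: "'a::chilbert_space operator"
  assumes lin: "linear_op T" and dense: "densely_defined T"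
    and sym: "\<And>x y. x \<in> dom T \<Longrightarrow> y \<in> dom T \<Longrightarrow> inner (the (T x)) y = inner x (the (T y))"
  shows "linear_op (op_closure T)" and "densely_defined (op_closure T)" and "closed_op (op_closure T)"
    and "dom T \<subseteq> dom (op_closure T)" and "\<And>x. x \<in> dom T \<Longrightarrow> the (op_closure T x) = the (T x)"
proof -
  let ?G = "closure (Map.graph T)"
  have weak: "inner (snd p) v = inner (fst p) (the (T v))" if "p \<in> ?G" "v \<in> dom T" for p v
  proof -
    have "closed {p. inner (snd p) v = inner (fst p) (the (T v))}"
      by (intro closed_Collect_eq continuous_intros)
    then have "?G \<subseteq> {p. inner (snd p) v = inner (fst p) (the (T v))}"
      using sym that(2) by (intro closure_minimal) (auto simp: graph_eq_image)
    then show ?thesis using that(1) by blast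
  qed
  have unique: "y = z" if "(x, y) \<in> ?G" "(x, z) \<in> ?G" for x y z
  proof -
    have "inner (y - z) v = 0" if "v \<in> dom T" for v
      using weak[OF \<open>(x, y) \<in> ?G\<close> that] weak[OF \<open>(x, z) \<in> ?G\<close> that] by (simp add: inner_diff_left)
    then have "y - z = 0"
      using dense by (intro orthogonal_to_dense[of "dom T"]) (simp_all add: densely_defined_def)
    then show ?thesis by simp
  qed
  have cl: "op_closure T x = Some y \<longleftrightarrow> (x, y) \<in> ?G" for x y
  proof -
    have "(THE y. (x, y) \<in> ?G) = z" if "(x, z) \<in> ?G" for z
      using that unique by (intro the_equality) auto
    then show ?thesis by (auto simp: op_closure_def)
  qed
  then have graph: "Map.graph (op_closure T) = ?G" by (auto simp: graph_def)
  then show "closed_op (op_closure T)" by (simp add: closed_op_def)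
  have ext: "op_closure T x = Some (the (T x))" if "x \<in> dom T" for x
    unfolding cl using that by (intro subsetD[OF closure_subset]) (auto simp: graph_eq_image)
  then show sub: "dom T \<subseteq> dom (op_closure T)" by (auto intro: domI)
  show "the (op_closure T x) = the (T x)" if "x \<in> dom T" for x using ext[OF that] by simp
  show "densely_defined (op_closure T)"
    using dense closure_mono[OF sub] unfolding densely_defined_def by blast
  have G: "(x, the (op_closure T x)) \<in> ?G" if "x \<in> dom (op_closure T)" for x
    unfolding cl[symmetric] using that by (auto simp: domIff)
  have "subspace (Map.graph T)"
    unfolding graph_eq_image by (rule subspace_graph_on[OF lin linear_op_subspace[OF lin] order_refl])
  then have subG: "subspace ?G" by (rule subspace_closure)
  show "linear_op (op_closure T)"
  proof (rule linear_opI)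
    show "0 \<in> dom (op_closure T)" using sub linear_op_0[OF lin] by blast
    fix x assume x: "x \<in> dom (op_closure T)"
    show "op_closure T (x + y) = Some (the (op_closure T x) + the (op_closure T y))"
      if "y \<in> dom (op_closure T)" for y
      unfolding cl using subspace_add[OF subG G[OF x] G[OF that]] by simp
    show "op_closure T (c *\<^sub>C x) = Some (c *\<^sub>C the (op_closure T x))" for c
    proof -
      let ?m = "\<lambda>p::'a \<times> 'a. (c *\<^sub>C fst p, c *\<^sub>C snd p)"
      have "?m ` ?G \<subseteq> ?G"
      proof (rule image_closure_subset)
        show "continuous_on ?G ?m"
          by (intro continuous_intros bounded_linear.continuous_on[OF bounded_linear_scaleC])
        have "?m ` Map.graph T \<subseteq> Map.graph T"
          using linear_op_scaleC[OF lin] linear_op_scaleC_dom[OF lin] by (auto simp: graph_eq_image)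
        then show "?m ` Map.graph T \<subseteq> ?G" using closure_subset by (rule order_trans)
      qed simp
      then have "?m (x, the (op_closure T x)) \<in> ?G" using G[OF x] by blast
      then show ?thesis unfolding cl by simp
    qed
  qed
qed

text \<open>
  The operator \<open>A* A = A A*\<close> represents the forms of both \<open>A\<close> and \<open>A*\<close>.
\<close>

lemma normal_op_adjoint:
  fixes A :: "'a::chilbert_space operator"
  assumes "normal_op A"
  shows "dom (op_adjoint A) = dom A"
    and "\<And>x. x \<in> dom A \<Longrightarrow> norm (the (op_adjoint A x)) = norm (the (A x))"
proof -
  have lin: "linear_op A" and dense: "densely_defined A" and cl: "closed_op A"
    and comm: "A \<circ>\<^sub>m op_adjoint A = op_adjoint A \<circ>\<^sub>m A" using assms by (auto simp: normal_op_def)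
  let ?S = "op_adjoint A \<circ>\<^sub>m A"
  have rep: "represents_form ?S A" by (rule represents_form_adjoint_comp[OF lin dense cl])
  have rep': "represents_form ?S (op_adjoint A)"
    unfolding represents_form_def
  proof (intro conjI ballI)
    show "dom ?S \<subseteq> dom (op_adjoint A)" unfolding comm[symmetric] by (auto simp: in_dom_map_comp)
    fix x v assume x: "x \<in> dom (op_adjoint A)" and v: "v \<in> dom ?S"
    have "v \<in> dom (op_adjoint A)" "the (op_adjoint A v) \<in> dom A"
      using v unfolding comm[symmetric] by (auto simp: in_dom_map_comp)
    then have "inner (the (?S v)) x = inner (the (op_adjoint A v)) (the (op_adjoint A x))"
      unfolding comm[symmetric] using op_adjoint_inner[OF lin dense _ x] by (simp add: the_map_comp)
    then show "inner (the (op_adjoint A x)) (the (op_adjoint A v)) = inner x (the (?S v))"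
      by (simp add: inner_commute)
  qed (use represents_formD(1,6)[OF rep] linear_op_adjoint[OF lin dense]
      closed_op_adjoint[OF lin dense] in auto)
  show "dom (op_adjoint A) = dom A" by (rule represents_form_same_dom_norm(1)[OF rep' rep])
  show "norm (the (op_adjoint A x)) = norm (the (A x))" if "x \<in> dom A" for x
    using represents_form_same_dom_norm(2)[OF rep rep' that] by simp
qed

theorem theorem3p7:
  fixes A :: "'a::chilbert_space operator"
  assumes "normal_op A"
    and "op_le (op_abs A) (op_abs (op_closure (op_Re A)))"
  shows "self_adjoint_op A"
proof -
  have lin: "linear_op A" and dense: "densely_defined A" and cl: "closed_op A"
    using assms(1) by (auto simp: normal_op_def)
  note adj = normal_op_adjoint[OF assms(1)]
  note adj_inner = op_adjoint_inner[OF lin dense]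
  note adj_lin = linear_op_adjoint[OF lin dense]
  have dom_Re: "dom (op_Re A) = dom A" 
  proof (rule set_eqI)
    show "x \<in> dom (op_Re A) \<longleftrightarrow> x \<in> dom A" for x
      by (subst domIff) (simp add: op_Re_def adj(1))
  qed
  have Re: "the (op_Re A x) = (1 / 2) *\<^sub>R (the (A x) + the (op_adjoint A x))" if "x \<in> dom A" for x
    using that scaleC_of_real[of "1 / 2"] by (simp add: op_Re_def adj(1))
  have Re_lin: "linear_op (op_Re A)"
    using lin adj_lin adj(1)
    by (auto simp: linear_op_def dom_Re Re scaleC_add_right algebra_simps)
      (simp_all add: scaleC_scaleC mult.commute flip: scaleC_of_real)
  have Re_dense: "densely_defined (op_Re A)" using dense by (simp add: densely_defined_def dom_Re)
  have Re_sym: "inner (the (op_Re A x)) y = inner x (the (op_Re A y))"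
    if "x \<in> dom (op_Re A)" "y \<in> dom (op_Re A)" for x y
  proof -
    have x: "x \<in> dom A" "x \<in> dom (op_adjoint A)" and y: "y \<in> dom A" "y \<in> dom (op_adjoint A)"
      using that by (simp_all add: dom_Re adj(1))
    show ?thesis
      using adj_inner[OF x(1) y(2)] adj_inner[OF y(1) x(2)]
      by (simp add: Re x y inner_add_left inner_add_right inner_commute)
  qed
  define B where "B = op_closure (op_Re A)"
  note B = op_closure_symmetric[OF Re_lin Re_dense Re_sym, folded B_def, unfolded dom_Re]
  define P Q where "P = op_abs A" and "Q = op_abs B"
  note P = op_abs_properties[OF lin dense cl, folded P_def]
  note Q = op_abs_properties[OF B(1-3), folded Q_def]
  have sub: "dom P \<subseteq> dom Q" using P(3) Q(3) B(4) by simp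
  \<comment> \<open>the parallelogram law for \<open>A x\<close> and \<open>A* x\<close>, which have equal norms\<close>
  have plaw: "(norm (the (A x) - the (op_adjoint A x)))\<^sup>2
      = 4 * ((norm (the (P x)))\<^sup>2 - (norm (the (Q x)))\<^sup>2)" if x: "x \<in> dom A" for x
  proof -
    have "norm (the (Q x)) = norm (the (A x) + the (op_adjoint A x)) / 2"
      using Q(4) B(4,5) x by (auto simp: Re)
    then have "(norm (the (Q x)))\<^sup>2 = (norm (the (A x) + the (op_adjoint A x)))\<^sup>2 / 4"
      by (simp only: power_divide) simp
    then show ?thesis
      using parallelogram_law[of "the (A x)" "the (op_adjoint A x)"]
      by (simp add: adj(2)[OF x] P(4)[OF x])
  qed
  have symP: "inner (the (P x)) y = inner x (the (P y))" if "x \<in> dom P" "y \<in> dom P" for x y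
    by (rule self_adjoint_inner[OF P(1) that])
  have symQ: "inner (the (Q x)) y = inner x (the (Q y))" if "x \<in> dom P" "y \<in> dom P" for x y
    using that sub by (intro self_adjoint_inner[OF Q(1)]) auto
  have forms: "inner (the (P x)) x = inner (the (Q x)) x" if x: "x \<in> dom P" for x
  proof (rule antisym)
    have xQ: "x \<in> dom Q" using x sub by blast
    \<comment> \<open>the hypothesis gives one inequality of the forms, the Heinz inequality the other\<close>
    have "norm (the (op_sqrt P x)) \<le> norm (the (op_sqrt Q x))"
      using assms(2) op_sqrt_form(1)[OF Q(1,2) xQ] by (simp add: op_le_def P_def Q_def B_def)
    then have "(norm (the (op_sqrt P x)))\<^sup>2 \<le> (norm (the (op_sqrt Q x)))\<^sup>2" by (simp add: power_mono)
    then show "inner (the (P x)) x \<le> inner (the (Q x)) x"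
      by (simp add: op_sqrt_form(2)[OF P(1,2) x] op_sqrt_form(2)[OF Q(1,2) xQ])
    have "norm (the (Q u)) \<le> norm (the (P u))" if "u \<in> dom P" for u
    proof -
      have "0 \<le> 4 * ((norm (the (P u)))\<^sup>2 - (norm (the (Q u)))\<^sup>2)"
        using plaw[of u] that P(3) by (metis zero_le_power2)
      then have "(norm (the (Q u)))\<^sup>2 \<le> (norm (the (P u)))\<^sup>2" by simp
      then show ?thesis by (rule power2_le_imp_le) simp
    qed
    then show "inner (the (Q x)) x \<le> inner (the (P x)) x"
      using P(2) by (intro heinz_inequality[OF P(1) _ symQ _ x]) (simp_all add: positive_op_iff_inner[OF P(1)])
  qed
  have "A = op_adjoint A"
  proof (rule operator_eqI[OF adj(1)[symmetric]])
    fix x assume x: "x \<in> dom A"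
    have "the (P x) = the (Q x)"
      by (intro symmetric_forms_eq[OF _ _ _ sub symP symQ forms])
        (simp_all add: self_adjoint_opD P(1,3) Q(1) x)
    then show "the (A x) = the (op_adjoint A x)" using plaw[OF x] by simp
  qed
  with lin dense show ?thesis unfolding self_adjoint_op_def by (intro conjI)
qed

end
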